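(* There exists a polynomial-time algorithm which, given agents $N$, objects $O$, a preference profile $\succsim=(\succsim_1,\dots,\succsim_n)$ over objects and an assignment $p$, decides whether $p$ is necessarily Pareto optimal with respect to $\succsim$.
   Context: $N=\{1,\dots,n\}$ is a set of agents and $O=\{o_1,\dots,o_m\}$ a set of objects. An assignment $p=(p(1),\dots,p(n))$ is a partition of $O$ into $n$ (possibly empty) subsets, $p(i)$ being the bundle of agent $i$. Each agent $i$ has a complete, transitive, reflexive preference relation $\succsim_i$ over $O$. $\mathcal U(\succsim)$ is the set of utility profiles $u=(u_1,\dots,u_n)$ with $u_i:O\to\mathbb R_{>0}$ consistent with $\succsim_i$ (i.e. $u_i(o)\ge u_i(o')$ iff $o\succsim_i o'$), extended additively to bundles: $u_i(S)=\sum_{o\in S}u_i(o)$. For a given $u$, assignment $q$ Pareto dominates $p$ if $u_i(q(i))\ge u_i(p(i))$ for all $i$ and $u_i(q(i))>u_i(p(i))$ for some $i$; $p$ is Pareto optimal for $u$ if no assignment Pareto dominates it. $p$ is necessarily Pareto optimal with respect to $\succsim$ if $p$ is Pareto optimal for every $u\in\mathcal U(\succsim)$. *)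

theory Defs
  imports
    Complex_Main
    "HOL-Library.Disjoint_Sets"
    "HOL-Library.Log_Nat"
    "HOL-Computational_Algebra.Polynomial"
begin

section \<open>Assignments and necessary Pareto optimality\<close>

text \<open>Bundles of agents outside \<open>N\<close> are irrelevant.\<close>

definition is_assignment :: "'a set \<Rightarrow> 'b set \<Rightarrow> ('a \<Rightarrow> 'b set) \<Rightarrow> bool" where
  "is_assignment N Ob p \<longleftrightarrow> (\<Union>i\<in>N. p i) = Ob \<and> disjoint_family_on p N"

text \<open>\<open>(a, b) \<in> R i\<close> means that agent \<open>i\<close> finds \<open>a\<close> at least as good as \<open>b\<close>.\<close>

definition is_preference_profile :: "'a set \<Rightarrow> 'b set \<Rightarrow> ('a \<Rightarrow> 'b rel) \<Rightarrow> bool" where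
  "is_preference_profile N Ob R \<longleftrightarrow> (\<forall>i\<in>N. preorder_on Ob (R i) \<and> total_on Ob (R i))"

definition utility_profiles :: "'a set \<Rightarrow> 'b set \<Rightarrow> ('a \<Rightarrow> 'b rel) \<Rightarrow> ('a \<Rightarrow> 'b \<Rightarrow> real) set" where
  "utility_profiles N Ob R =
    {u. \<forall>i\<in>N. (\<forall>a\<in>Ob. u i a > 0) \<and> (\<forall>a\<in>Ob. \<forall>b\<in>Ob. u i a \<ge> u i b \<longleftrightarrow> (a, b) \<in> R i)}"

definition bundle_utility :: "('a \<Rightarrow> 'b \<Rightarrow> real) \<Rightarrow> 'a \<Rightarrow> 'b set \<Rightarrow> real" where
  "bundle_utility u i S = (\<Sum>a\<in>S. u i a)"

definition pareto_dominates ::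
  "'a set \<Rightarrow> ('a \<Rightarrow> 'b \<Rightarrow> real) \<Rightarrow> ('a \<Rightarrow> 'b set) \<Rightarrow> ('a \<Rightarrow> 'b set) \<Rightarrow> bool" where
  "pareto_dominates N u q p \<longleftrightarrow>
     (\<forall>i\<in>N. bundle_utility u i (q i) \<ge> bundle_utility u i (p i)) \<and>
     (\<exists>i\<in>N. bundle_utility u i (q i) > bundle_utility u i (p i))"

definition pareto_optimal ::
  "'a set \<Rightarrow> 'b set \<Rightarrow> ('a \<Rightarrow> 'b \<Rightarrow> real) \<Rightarrow> ('a \<Rightarrow> 'b set) \<Rightarrow> bool" where
  "pareto_optimal N Ob u p \<longleftrightarrow> \<not> (\<exists>q. is_assignment N Ob q \<and> pareto_dominates N u q p)"

definition necessarily_pareto_optimal ::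
  "'a set \<Rightarrow> 'b set \<Rightarrow> ('a \<Rightarrow> 'b rel) \<Rightarrow> ('a \<Rightarrow> 'b set) \<Rightarrow> bool" where
  "necessarily_pareto_optimal N Ob R p \<longleftrightarrow> (\<forall>u \<in> utility_profiles N Ob R. pareto_optimal N Ob u p)"


section \<open>Polynomial time\<close>

text \<open>
  The machine model is the random access machine with addition and truncated subtraction
  under the logarithmic cost criterion (Cook and Reckhow 1973; Aho, Hopcroft and Ullman 1974),
  which is polynomially equivalent to Turing machines.  Programs are written with structured
  control flow instead of jumps.  A state consists of registers, which are addressed by
  constants in the program text only, and of an indirectly addressed memory.
\<close>

type_synonym reg = nat
type_synonym state = "(reg \<Rightarrow> nat) \<times> (nat \<Rightarrow> nat)"

datatype com =
    Const reg nat
  | Add reg reg reg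
  | Sub reg reg reg
  | Load reg reg
  | Store reg reg
  | Seq com com
  | If reg com com
  | While reg com

text \<open>\<open>floorlog 2 x\<close> is the number of binary digits of \<open>x\<close> (and \<open>0\<close> for \<open>x = 0\<close>).\<close>

definition lcost :: "nat \<Rightarrow> nat" where
  "lcost x = 1 + floorlog 2 x"

text \<open>
  \<open>exec c s t s'\<close>: started in \<open>s\<close>, the program \<open>c\<close> halts in \<open>s'\<close> after time \<open>t\<close>.
  Each step is charged for the lengths of all operands and addresses it reads.
\<close>

inductive exec :: "com \<Rightarrow> state \<Rightarrow> nat \<Rightarrow> state \<Rightarrow> bool" where
  Const: "exec (Const r k) (\<rho>, \<mu>) (lcost k) (\<rho>(r := k), \<mu>)"
| Add: "exec (Add r x y) (\<rho>, \<mu>) (lcost (\<rho> x) + lcost (\<rho> y)) (\<rho>(r := \<rho> x + \<rho> y), \<mu>)"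
| Sub: "exec (Sub r x y) (\<rho>, \<mu>) (lcost (\<rho> x) + lcost (\<rho> y)) (\<rho>(r := \<rho> x - \<rho> y), \<mu>)"
| Load: "exec (Load r x) (\<rho>, \<mu>) (lcost (\<rho> x) + lcost (\<mu> (\<rho> x))) (\<rho>(r := \<mu> (\<rho> x)), \<mu>)"
| Store: "exec (Store x y) (\<rho>, \<mu>) (lcost (\<rho> x) + lcost (\<rho> y)) (\<rho>, \<mu>(\<rho> x := \<rho> y))"
| Seq: "exec c1 s t1 s' \<Longrightarrow> exec c2 s' t2 s'' \<Longrightarrow> exec (Seq c1 c2) s (t1 + t2) s''"
| IfNonzero: "\<rho> x \<noteq> 0 \<Longrightarrow> exec c1 (\<rho>, \<mu>) t s' \<Longrightarrow> exec (If x c1 c2) (\<rho>, \<mu>) (lcost (\<rho> x) + t) s'"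
| IfZero: "\<rho> x = 0 \<Longrightarrow> exec c2 (\<rho>, \<mu>) t s' \<Longrightarrow> exec (If x c1 c2) (\<rho>, \<mu>) (lcost (\<rho> x) + t) s'"
| WhileZero: "\<rho> x = 0 \<Longrightarrow> exec (While x c) (\<rho>, \<mu>) (lcost (\<rho> x)) (\<rho>, \<mu>)"
| WhileNonzero: "\<rho> x \<noteq> 0 \<Longrightarrow> exec c (\<rho>, \<mu>) t1 s' \<Longrightarrow> exec (While x c) s' t2 s'' \<Longrightarrow>
    exec (While x c) (\<rho>, \<mu>) (lcost (\<rho> x) + t1 + t2) s''"

inductive_cases ConstE: "exec (Const r k) s t s'"
inductive_cases AddE: "exec (Add r x y) s t s'"
inductive_cases SubE: "exec (Sub r x y) s t s'"
inductive_cases LoadE: "exec (Load r x) s t s'"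
inductive_cases StoreE: "exec (Store x y) s t s'"
inductive_cases SeqE: "exec (Seq c1 c2) s t s'"
inductive_cases IfE: "exec (If x c1 c2) s t s'"
inductive_cases WhileE: "exec (While x c) s t s'"

text \<open>In particular, the time and the result of a terminating program are unique.\<close>

lemma exec_deterministic:
  "exec c s t s' \<Longrightarrow> exec c s u s'' \<Longrightarrow> t = u \<and> s' = s''"
proof (induction arbitrary: u s'' rule: exec.induct)
  case Const
  then show ?case by (auto elim: ConstE)
next
  case Add
  then show ?case by (auto elim: AddE)
next
  case Sub
  then show ?case by (auto elim: SubE)
next
  case Load
  then show ?case by (auto elim: LoadE)
next
  case Store
  then show ?case by (auto elim: StoreE)
next
  case Seq
  from Seq.prems show ?case by (rule SeqE) (metis Seq.IH)
next
  case IfNonzero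
  from IfNonzero.prems show ?case by (rule IfE) (use IfNonzero.hyps in \<open>auto dest: IfNonzero.IH\<close>)
next
  case IfZero
  from IfZero.prems show ?case by (rule IfE) (use IfZero.hyps in \<open>auto dest: IfZero.IH\<close>)
next
  case WhileZero
  from WhileZero.prems show ?case by (rule WhileE) (use WhileZero.hyps in auto)
next
  case (WhileNonzero \<rho> x c \<mu> t1 s1 t2 s2)
  from WhileNonzero.prems show ?case
  proof (rule WhileE)
    fix \<rho>' \<mu>' v1 r1 v2
    assume *: "(\<rho>, \<mu>) = (\<rho>', \<mu>')" "u = lcost (\<rho>' x) + v1 + v2"
      "exec c (\<rho>', \<mu>') v1 r1" "exec (While x c) r1 v2 s''"
    then have "t1 = v1" "s1 = r1"
      using WhileNonzero.IH(1) by blast+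
    moreover from this * have "t2 = v2" "s2 = s''"
      using WhileNonzero.IH(2) by blast+
    ultimately show ?thesis using * by simp
  qed (use WhileNonzero.hyps in simp)
qed

text \<open>The input is stored in memory from address \<open>0\<close> on; everything else is initially \<open>0\<close>.\<close>

definition init_state :: "nat list \<Rightarrow> state" where
  "init_state ws = ((\<lambda>_. 0), (\<lambda>k. if k < length ws then ws ! k else 0))"

definition input_size :: "nat list \<Rightarrow> nat" where
  "input_size ws = (\<Sum>w\<leftarrow>ws. lcost w)"

text \<open>
  The property \<open>Q\<close> of the instances \<open>I\<close>, presented to the machine via \<open>enc\<close>, is decided
  by one program whose running time is bounded by one polynomial in the input size.
  The answer is returned in register \<open>0\<close>.
\<close>

definition polynomial_time_decidable ::
  "'i set \<Rightarrow> ('i \<Rightarrow> nat list) \<Rightarrow> ('i \<Rightarrow> bool) \<Rightarrow> bool" where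
  "polynomial_time_decidable I enc Q \<longleftrightarrow>
    (\<exists>(c :: com) (b :: nat poly). \<forall>x\<in>I. \<exists>t \<rho> \<mu>.
       exec c (init_state (enc x)) t (\<rho>, \<mu>) \<and>
       t \<le> poly b (input_size (enc x)) \<and>
       \<rho> 0 = (if Q x then 1 else 0))"


section \<open>Instances\<close>

text \<open>The agents are \<open>{1..n}\<close>; the object \<open>o\<^sub>j\<close> is represented by its index \<open>j \<in> {1..m}\<close>.\<close>

type_synonym inst = "nat \<times> nat \<times> (nat \<Rightarrow> nat rel) \<times> (nat \<Rightarrow> nat set)"

definition instances :: "inst set" where
  "instances = {(n, m, R, p). is_preference_profile {1..n} {1..m} R \<and> is_assignment {1..n} {1..m} p}"

text \<open>
  The numbers \<open>n\<close> and \<open>m\<close>, followed by the Boolean \<open>m \<times> m\<close> matrices of the \<open>n\<close> preference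
  relations and by the \<open>n\<close> characteristic vectors of the bundles.
\<close>

fun encode :: "inst \<Rightarrow> nat list" where
  "encode (n, m, R, p) =
     [n, m]
     @ [of_bool ((a, b) \<in> R i). i \<leftarrow> [1..<Suc n], a \<leftarrow> [1..<Suc m], b \<leftarrow> [1..<Suc m]]
     @ [of_bool (a \<in> p i). i \<leftarrow> [1..<Suc n], a \<leftarrow> [1..<Suc m]]"

end

(*
  An assignment is necessarily Pareto optimal iff (a) no agent j owns two objects that j both
  likes strictly less than a single object x owned by someone else, and (b) the digraph with an
  edge from x to y whenever the owner of y weakly prefers x to y has no cycle through a strict
  edge.

  If (a) fails, exchange x for the two objects: j profits if its utilities are powers of 3 of
  the ranks, the other agent profits if its utilities are almost constant. If (b) fails, shift
  objects along a shortest cycle. Conversely, let q dominate p under u. By (a), every agent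
  receives at least as many objects as it gives away, hence exactly as many; then either
  everything it receives is strictly better than the worst object it gives away, or received and
  given objects can be matched with equal utilities. The number of objects reachable in the
  digraph is, by (b), a potential that drops along strict edges, and counting moved objects of
  small potential gives a contradiction.

  Both conditions are bounded first-order formulas over the input and a transitive closure. Sums
  bounded by n and m evaluate such formulas in a number of steps polynomial in n and m.
*)
theory Submission
  imports Defs
begin

section \<open>Combinatorial characterization\<close>

text \<open>Domination compares sums only: an agent may accept a worse object if other received
  objects compensate, so the exchange from \<open>p\<close> to \<open>q\<close> need not split into
  cycles of acceptable moves. Condition (a) limits the compensation. Of the objects that an agent
  gives away, all but one worst object are at least as good as everything it receives, so
  compensation can take place only at that worst object. The strict gains left over belong to agents
  whose exchanges need not lie on a common cycle; instead of searching for a cycle, the proof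
  compares receipts and losses below a threshold of the potential, the least potential of the worst
  object given away by such an agent. The two kinds of failure differ in strength: shifting along a
  cycle is an improvement under every consistent profile, whereas a swap needs a profile in which
  the partners have opposite extremes. Such a profile exists because utilities are chosen agent by
  agent.\<close>

text \<open>
  For an agent who gives away \<open>B\<close> and receives \<open>A\<close>; without one-for-two swaps, only the worst
  object \<open>w\<close> of \<open>B\<close> can be worse than an object of \<open>A\<close>.
\<close>

lemma card_le_of_sum_ge:
  fixes u :: "'b \<Rightarrow> real"
  assumes fin: "finite A" "finite B"
    and pos: "\<And>b. b \<in> B \<Longrightarrow> u b > 0"
    and w: "w \<in> B" "\<And>a b. a \<in> A \<Longrightarrow> b \<in> B - {w} \<Longrightarrow> u a \<le> u b"
    and ge: "sum u B \<le> sum u A"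
  shows "card B \<le> card A"
proof (rule ccontr)
  assume "\<not> card B \<le> card A"
  then have "card A \<le> card (B - {w})"
    using w(1) by simp
  then obtain h where h: "h ` A \<subseteq> B - {w}" "inj_on h A"
    using card_le_inj[OF fin(1), of "B - {w}"] fin(2) by blast
  have "sum u A \<le> sum (u \<circ> h) A"
    using h(1) by (intro sum_mono) (auto intro!: w(2))
  also have "\<dots> = sum u (h ` A)"
    using sum.reindex[OF h(2), of u] by simp
  also have "\<dots> \<le> sum u (B - {w})"
    using h(1) fin(2) by (intro sum_mono2) (auto intro: less_imp_le pos)
  also have "\<dots> < sum u B"
    using w(1) fin(2) pos[OF w(1)] by (simp add: sum_diff1)
  finally show False
    using ge by simp
qed

text \<open>Set aside a worst element \<open>x\<close> of \<open>A\<close> and the exceptional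
  \<open>w\<close>: along any bijection from the rest of \<open>A\<close> to the rest of
  \<open>B\<close>, utility never decreases. If \<open>u x \<le> u w\<close>, the reverse inequality
  between the full sums leaves no slack anywhere, and the bijection extended by sending
  \<open>x\<close> to \<open>w\<close> preserves utility.\<close>

lemma uniform_gain_or_matching:
  fixes u :: "'b \<Rightarrow> real"
  assumes fin: "finite A" "finite B"
    and w: "w \<in> B" "\<And>a b. a \<in> A \<Longrightarrow> b \<in> B - {w} \<Longrightarrow> u a \<le> u b"
    and ge: "sum u B \<le> sum u A" and card: "card A = card B"
  shows "(\<forall>a\<in>A. u w < u a) \<or> sum u A = sum u B \<and> (\<exists>\<sigma>. bij_betw \<sigma> A B \<and> (\<forall>a\<in>A. u a = u (\<sigma> a)))"
proof -
  have "A \<noteq> {}"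
    using w(1) fin card by auto
  then obtain x where x: "x \<in> A" "\<And>a. a \<in> A \<Longrightarrow> u x \<le> u a"
    using fin(1) arg_min_if_finite(1)[of A u] arg_min_least[of A _ u] by metis
  have "card (A - {x}) = card (B - {w})"
    using x(1) w(1) card by simp
  then obtain h where h: "bij_betw h (A - {x}) (B - {w})"
    using fin by (metis bij_betw_iff_card finite_Diff)
  have le: "u a \<le> u (h a)" if "a \<in> A - {x}" for a
    using that w(2) bij_betwE[OF h] by auto
  have eq: "(\<Sum>a\<in>A - {x}. u (h a)) = sum u (B - {w})"
    using sum.reindex_bij_betw[OF h] .
  have sum_le: "sum u (A - {x}) \<le> sum u (B - {w})"
    unfolding eq[symmetric] using le by (rule sum_mono)
  have sums: "sum u (A - {x}) = sum u A - u x" "sum u (B - {w}) = sum u B - u w"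
    using x(1) w(1) fin by (auto simp: sum_diff1)
  show ?thesis
  proof (cases "u w < u x")
    case True
    then show ?thesis
      using x(2) by force
  next
    case False
    have "sum u (A - {x}) = sum u (B - {w})" "u x = u w" "sum u A = sum u B"
      using False sum_le ge unfolding sums by linarith+
    note tight = this
    have "u a = u (h a)" if "a \<in> A - {x}" for a
    proof (rule ccontr)
      assume "u a \<noteq> u (h a)"
      then have "sum u (A - {x}) < (\<Sum>a\<in>A - {x}. u (h a))"
        using le that fin(1) by (intro sum_strict_mono_ex1) (auto simp: less_le)
      then show False
        using tight(1) eq by simp
    qed
    moreover have "bij_betw (h(x := w)) A B"
    proof -
      have "bij_betw (h(x := w)) (A - {x}) (B - {w})"
        using h by (rule bij_betw_cong[THEN iffD1, rotated]) auto
      then have "bij_betw (h(x := w)) ((A - {x}) \<union> {x}) ((B - {w}) \<union> {w})"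
        by (intro bij_betw_combine) (auto simp: bij_betw_def)
      then show ?thesis
        using x(1) w(1) by (simp add: insert_absorb)
    qed
    ultimately have "bij_betw (h(x := w)) A B \<and> (\<forall>a\<in>A. u a = u ((h(x := w)) a))"
      using tight(2) by auto
    then show ?thesis
      using tight(3) by blast
  qed
qed

section \<open>Ordinal conditions that exclude domination\<close>

text \<open>\<open>(x, y)\<close> is a move if the owner of \<open>y\<close> would accept \<open>x\<close> in its place.\<close>

definition acceptable_moves :: "'a set \<Rightarrow> 'b set \<Rightarrow> ('a \<Rightarrow> 'b rel) \<Rightarrow> ('a \<Rightarrow> 'b set) \<Rightarrow> 'b rel" where
  "acceptable_moves N Ob R p = {(x, y). x \<in> Ob \<and> (\<exists>i\<in>N. y \<in> p i \<and> (x, y) \<in> R i)}"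

definition improving_moves :: "'a set \<Rightarrow> 'b set \<Rightarrow> ('a \<Rightarrow> 'b rel) \<Rightarrow> ('a \<Rightarrow> 'b set) \<Rightarrow> 'b rel" where
  "improving_moves N Ob R p = {(x, y). x \<in> Ob \<and> (\<exists>i\<in>N. y \<in> p i \<and> (x, y) \<in> R i \<and> (y, x) \<notin> R i)}"

definition has_improving_cycle :: "'a set \<Rightarrow> 'b set \<Rightarrow> ('a \<Rightarrow> 'b rel) \<Rightarrow> ('a \<Rightarrow> 'b set) \<Rightarrow> bool" where
  "has_improving_cycle N Ob R p \<longleftrightarrow>
    (\<exists>x y. (x, y) \<in> improving_moves N Ob R p \<and> (y, x) \<in> (acceptable_moves N Ob R p)\<^sup>+)"

text \<open>For total \<open>R i\<close>, \<open>(y, x) \<notin> R i\<close> says that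
  \<open>x\<close> is strictly better than \<open>y\<close>. The preferences of the present owner of
  \<open>x\<close> do not enter: with almost constant utilities, any two objects compensate that
  agent.\<close>

definition has_one_for_two_swap :: "'a set \<Rightarrow> 'b set \<Rightarrow> ('a \<Rightarrow> 'b rel) \<Rightarrow> ('a \<Rightarrow> 'b set) \<Rightarrow> bool" where
  "has_one_for_two_swap N Ob R p \<longleftrightarrow>
    (\<exists>i\<in>N. \<exists>x\<in>Ob. \<exists>y\<in>p i. \<exists>z\<in>p i. x \<notin> p i \<and> y \<noteq> z \<and> (y, x) \<notin> R i \<and> (z, x) \<notin> R i)"

lemma sum_card_assignment:
  assumes "finite N" "finite Ob" "is_assignment N Ob p" "S \<subseteq> Ob"
  shows "(\<Sum>i\<in>N. card (p i \<inter> S)) = card S"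
proof -
  have U: "(\<Union>i\<in>N. p i \<inter> S) = S"
    using assms(3,4) by (auto simp: is_assignment_def)
  have "card (\<Union>i\<in>N. p i \<inter> S) = (\<Sum>i\<in>N. card (p i \<inter> S))"
  proof (rule card_UN_disjoint)
    show "\<forall>i\<in>N. finite (p i \<inter> S)"
      using assms(2,4) finite_subset by blast
    show "\<forall>i\<in>N. \<forall>j\<in>N. i \<noteq> j \<longrightarrow> (p i \<inter> S) \<inter> (p j \<inter> S) = {}"
      using assms(3) by (auto simp: is_assignment_def disjoint_family_on_def)
  qed (use assms(1) in auto)
  with U show ?thesis
    by simp
qed

lemma no_domination:
  assumes fin: "finite N" "finite Ob"
    and R: "is_preference_profile N Ob R"
    and p: "is_assignment N Ob p"
    and u: "u \<in> utility_profiles N Ob R"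
    and no_cycle: "\<not> has_improving_cycle N Ob R p"
    and no_swap: "\<not> has_one_for_two_swap N Ob R p"
    and q: "is_assignment N Ob q"
  shows "\<not> pareto_dominates N u q p"
proof
  assume dom: "pareto_dominates N u q p"
  define E where "E = acceptable_moves N Ob R p"
  define In where "In j = q j - p j" for j
  define Out where "Out j = p j - q j" for j
  have sub: "p j \<subseteq> Ob" "q j \<subseteq> Ob" if "j \<in> N" for j
    using p q that by (auto simp: is_assignment_def)
  have finp: "finite (p j)" "finite (q j)" if "j \<in> N" for j
    using sub[OF that] fin(2) finite_subset by blast+
  have inout: "In j \<subseteq> Ob" "Out j \<subseteq> Ob" "finite (In j)" "finite (Out j)" if "j \<in> N" for j
    using sub[OF that] finp[OF that] by (auto simp: In_def Out_def)
  have u_pos: "u j a > 0" if "j \<in> N" "a \<in> Ob" for j a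
    using u that by (auto simp: utility_profiles_def)
  have u_iff: "u j b \<le> u j a \<longleftrightarrow> (a, b) \<in> R j" if "j \<in> N" "a \<in> Ob" "b \<in> Ob" for j a b
    using u that by (auto simp: utility_profiles_def)
  have split: "sum f (q j) = sum f (q j \<inter> p j) + sum f (In j)"
    "sum f (p j) = sum f (q j \<inter> p j) + sum f (Out j)" if "j \<in> N" for j and f :: "'b \<Rightarrow> real"
    using sum.Int_Diff[OF finp(2)[OF that], of f "p j"] sum.Int_Diff[OF finp(1)[OF that], of f "q
        j"]
    by (simp_all add: In_def Out_def Int_commute)
  have ge: "sum (u j) (Out j) \<le> sum (u j) (In j)" if "j \<in> N" for j
    using dom that split[OF that, of "u j"]
    by (auto simp: pareto_dominates_def bundle_utility_def dest!: bspec)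
  obtain j0 where j0: "j0 \<in> N" "sum (u j0) (Out j0) < sum (u j0) (In j0)"
  proof -
    obtain j where "j \<in> N" "bundle_utility u j (p j) < bundle_utility u j (q j)"
      using dom by (auto simp: pareto_dominates_def)
    with that[of j] split[of j "u j"] show thesis
      by (auto simp: bundle_utility_def)
  qed
  \<comment> \<open>Each object of \<open>S\<close> has exactly one owner under \<open>p\<close> and
    one under \<open>q\<close>. Kept objects cancel, so receipts and losses within \<open>S\<close>
    agree in total.\<close>
  have flow: "(\<Sum>j\<in>N. card (In j \<inter> S)) = (\<Sum>j\<in>N. card (Out j \<inter> S))" if "S \<subseteq> Ob" for S
  proof -
    have "card (q j \<inter> S) = card (q j \<inter> p j \<inter> S) + card (In j \<inter> S)"
      "card (p j \<inter> S) = card (q j \<inter> p j \<inter> S) + card (Out j \<inter> S)" if "j \<in> N" for j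
    proof -
      have "q j \<inter> S = (q j \<inter> p j \<inter> S) \<union> (In j \<inter> S)" "p j \<inter> S = (q j \<inter> p j \<inter> S) \<union> (Out j \<inter> S)"
        by (auto simp: In_def Out_def)
      moreover have "(q j \<inter> p j \<inter> S) \<inter> (In j \<inter> S) = {}" "(q j \<inter> p j \<inter> S) \<inter> (Out j \<inter> S) = {}"
        by (auto simp: In_def Out_def)
      ultimately show "card (q j \<inter> S) = card (q j \<inter> p j \<inter> S) + card (In j \<inter> S)"
        "card (p j \<inter> S) = card (q j \<inter> p j \<inter> S) + card (Out j \<inter> S)"
        using finp[OF that] inout[OF that] by (metis card_Un_disjoint finite_Int)+
    qed
    then have "(\<Sum>j\<in>N. card (q j \<inter> S)) = (\<Sum>j\<in>N. card (q j \<inter> p j \<inter> S)) + (\<Sum>j\<in>N. card (In j \<inter> S))"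
      "(\<Sum>j\<in>N. card (p j \<inter> S)) = (\<Sum>j\<in>N. card (q j \<inter> p j \<inter> S)) + (\<Sum>j\<in>N. card (Out j \<inter> S))"
      by (simp_all add: sum.distrib)
    then show ?thesis
      using sum_card_assignment[OF fin p that] sum_card_assignment[OF fin q that] by simp
  qed
  have "\<exists>w\<in>Out j. \<forall>b\<in>Out j. u j w \<le> u j b" if "j \<in> N" "Out j \<noteq> {}" for j
    using inout(4)[OF that(1)] that(2) arg_min_if_finite(1)[of "Out j" "u j"] arg_min_least[of
        "Out j" _ "u j"]
    by metis
  then obtain w where w: "\<And>j. j \<in> N \<Longrightarrow> Out j \<noteq> {} \<Longrightarrow> w j \<in> Out j"
    "\<And>j b. j \<in> N \<Longrightarrow> b \<in> Out j \<Longrightarrow> u j (w j) \<le> u j b"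
    by (metis empty_iff)
  \<comment> \<open>If both \<open>b\<close> and \<open>w j\<close> were worse than the received
    object \<open>a\<close>, the two would form a one-for-two swap for \<open>a\<close>.\<close>
  have top: "u j a \<le> u j b" if j: "j \<in> N" and a: "a \<in> In j" and b: "b \<in> Out j - {w j}" for j a b
  proof (rule ccontr)
    assume "\<not> u j a \<le> u j b"
    then have less: "u j b < u j a" "u j (w j) < u j a"
      using w(2)[OF j, of b] b by auto
    have w': "w j \<in> Out j"
      using w(1)[OF j] b by auto
    have "(b, a) \<notin> R j" "(w j, a) \<notin> R j"
      using less u_iff[OF j] inout(1,2)[OF j] a b w' by (meson DiffD1 linorder_not_less subsetD)+
    then have "has_one_for_two_swap N Ob R p"
      unfolding has_one_for_two_swap_def
      using j a b w' inout(1)[OF j]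
      by (intro bexI[of _ j] bexI[of _ a] bexI[of _ b] bexI[of _ "w j"]) (auto simp: In_def Out_def)
    then show False
      using no_swap by blast
  qed
  have card_ge: "card (Out j) \<le> card (In j)" if "j \<in> N" for j
  proof (cases "Out j = {}")
    case False
    show ?thesis
      using inout[OF that] w(1)[OF that False] top[OF that] ge[OF that]
      by (intro card_le_of_sum_ge[where u = "u j" and w = "w j"]) (auto intro: u_pos[OF that])
  qed simp
  \<comment> \<open>Nobody receives fewer objects than given away, and the totals agree; a surplus
    of one agent would have to be a deficit of another.\<close>
  have card_eq: "card (In j) = card (Out j)" if "j \<in> N" for j
  proof (rule ccontr)
    assume "card (In j) \<noteq> card (Out j)"
    then have "(\<Sum>j\<in>N. card (Out j)) < (\<Sum>j\<in>N. card (In j))"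
      using card_ge that fin(1) by (intro sum_strict_mono_ex1) (auto intro!: bexI[of _ j] simp:
          less_le)
    moreover have "(\<Sum>j\<in>N. card (Out j)) = (\<Sum>j\<in>N. card (In j))"
      using flow[of Ob] inout by (simp add: Int_absorb2)
    ultimately show False
      by simp
  qed
  \<comment> \<open>An agent that gives nothing away receives nothing either, by
    \<open>card_eq\<close>; it is kept out of \<open>G\<close>, where \<open>w j\<close> has to be
    meaningful, and is served by the empty matching.\<close>
  define G where "G = {j \<in> N. Out j \<noteq> {} \<and> (\<forall>a\<in>In j. u j (w j) < u j a)}"
  have matching: "\<exists>\<sigma>. bij_betw \<sigma> (In j) (Out j) \<and> (\<forall>a\<in>In j. u j a = u j (\<sigma> a))"
    if "j \<in> N" "j \<notin> G" for j
  proof (cases "Out j = {}")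
    case True
    then have "In j = {}"
      using card_eq[OF that(1)] inout(3)[OF that(1)] by auto
    then show ?thesis
      using True by (auto simp: bij_betw_def)
  next
    case False
    then show ?thesis
      using uniform_gain_or_matching[OF inout(3,4)[OF that(1)] w(1)[OF that(1) False] top[OF
          that(1)] ge[OF that(1)] card_eq[OF that(1)]]
        that by (auto simp: G_def)
  qed
  \<comment> \<open>The strict gain of \<open>j0\<close> rules out an equal-utility
    matching.\<close>
  have "j0 \<in> G"
  proof (rule ccontr)
    assume "j0 \<notin> G"
    then obtain \<sigma> where "bij_betw \<sigma> (In j0) (Out j0)" "\<forall>a\<in>In j0. u j0 a = u j0 (\<sigma> a)"
      using matching[OF j0(1)] by blast
    then have "sum (u j0) (In j0) = sum (u j0) (Out j0)"
      using sum.reindex_bij_betw[of \<sigma> "In j0" "Out j0" "u j0"] by simp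
    then show False
      using j0(2) by simp
  qed
  \<comment> \<open>The reflexive closure gives strictness: along an improving edge from
    \<open>x\<close> to \<open>y\<close>, the object \<open>x\<close> is reachable from itself but
    not from \<open>y\<close>, since that would close an improving cycle.\<close>
  define \<phi> where "\<phi> x = card {y \<in> Ob. (x, y) \<in> E\<^sup>*}" for x
  have \<phi>_mono: "\<phi> y \<le> \<phi> x" if "(x, y) \<in> E" for x y
    unfolding \<phi>_def using fin(2) that by (intro card_mono) auto
  have \<phi>_strict: "\<phi> y < \<phi> x" if xy: "(x, y) \<in> improving_moves N Ob R p" for x y
  proof -
    have "(x, y) \<in> E" "x \<in> Ob"
      using xy by (auto simp: E_def acceptable_moves_def improving_moves_def)
    moreover have "(y, x) \<notin> E\<^sup>*"
    proof
      assume "(y, x) \<in> E\<^sup>*"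
      moreover have "x \<noteq> y"
        using xy by (auto simp: improving_moves_def)
      ultimately have "(y, x) \<in> E\<^sup>+"
        by (metis rtranclD)
      then show False
        using no_cycle xy unfolding has_improving_cycle_def E_def by blast
    qed
    ultimately show ?thesis
      unfolding \<phi>_def using fin(2)
      by (intro psubset_card_mono) auto
  qed
  have move: "(a, b) \<in> E" if "j \<in> N" "a \<in> In j" "b \<in> Out j" "u j b \<le> u j a" for j a b
    using that u_iff[of j a b] inout[OF that(1)]
    by (auto simp: E_def acceptable_moves_def Out_def)
  have strict: "(a, b) \<in> improving_moves N Ob R p" if "j \<in> N" "a \<in> In j" "b \<in> Out j" "u j b < u j
      a" for j a b
  proof -
    have ab: "a \<in> Ob" "b \<in> Ob" "b \<in> p j"
      using that inout[OF that(1)] by (auto simp: Out_def)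
    then have "(a, b) \<in> R j" "(b, a) \<notin> R j"
      using that u_iff[OF that(1), of a b] u_iff[OF that(1), of b a] by auto
    with ab that(1) show ?thesis
      by (auto simp: improving_moves_def)
  qed
  have "finite G" "G \<noteq> {}" "G \<subseteq> N"
    using fin(1) \<open>j0 \<in> G\<close> by (auto simp: G_def)
  then obtain j1 where j1: "j1 \<in> G" "\<And>j. j \<in> G \<Longrightarrow> \<phi> (w j1) \<le> \<phi> (w j)"
    using arg_min_if_finite(1)[of G "\<lambda>j. \<phi> (w j)"] arg_min_least[of G _ "\<lambda>j. \<phi> (w j)"] by metis
  \<comment> \<open>Objects of small potential are never received by agents in \<open>G\<close>, yet \<open>w j1\<close> is given away.\<close>
  define S where "S = {x \<in> Ob. \<phi> x \<le> \<phi> (w j1)}"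
  have SG: "In j \<inter> S = {}" if "j \<in> G" for j
  proof -
    have "\<phi> (w j1) < \<phi> a" if "a \<in> In j" for a
    proof -
      have "j \<in> N" "Out j \<noteq> {}" "u j (w j) < u j a"
        using \<open>j \<in> G\<close> that by (auto simp: G_def)
      then have "\<phi> (w j) < \<phi> a"
        using \<phi>_strict[OF strict[OF _ that w(1)]] by blast
      then show ?thesis
        using j1(2)[OF \<open>j \<in> G\<close>] by simp
    qed
    then show ?thesis
      by (force simp: S_def)
  qed
  \<comment> \<open>Outside \<open>G\<close> the matching sends each received object along a move,
    where \<open>\<phi>\<close> cannot grow; so it injects the received part of \<open>S\<close>
    into the part given away.\<close>
  have le: "card (In j \<inter> S) \<le> card (Out j \<inter> S)" if "j \<in> N" for j
  proof (cases "j \<in> G")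
    case False
    then obtain \<sigma> where \<sigma>: "bij_betw \<sigma> (In j) (Out j)" "\<forall>a\<in>In j. u j a = u j (\<sigma> a)"
      using matching[OF \<open>j \<in> N\<close>] by blast
    have "\<sigma> a \<in> Out j \<inter> S" if a: "a \<in> In j \<inter> S" for a
    proof -
      have "\<sigma> a \<in> Out j"
        using a \<sigma>(1) by (auto dest: bij_betwE)
      moreover from this have "(a, \<sigma> a) \<in> E"
        using a \<sigma>(2) \<open>j \<in> N\<close> by (intro move) auto
      ultimately show ?thesis
        using a \<phi>_mono[of a "\<sigma> a"] inout(2)[OF \<open>j \<in> N\<close>] by (auto simp: S_def)
    qed
    moreover have "inj_on \<sigma> (In j \<inter> S)"
      using \<sigma>(1) by (auto simp: bij_betw_def intro: inj_on_subset)
    ultimately show ?thesis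
      using inout(4)[OF that] by (intro card_inj_on_le[of \<sigma>]) auto
  qed (simp add: SG)
  have "w j1 \<in> Out j1 \<inter> S" "j1 \<in> N"
    using j1(1) w(1)[of j1] inout(2)[of j1] by (auto simp: G_def S_def)
  then have "card (In j1 \<inter> S) < card (Out j1 \<inter> S)"
    using SG[OF j1(1)] inout(4)[of j1] by (auto simp: card_gt_0_iff)
  then have "(\<Sum>j\<in>N. card (In j \<inter> S)) < (\<Sum>j\<in>N. card (Out j \<inter> S))"
    using le \<open>j1 \<in> N\<close> fin(1) by (intro sum_strict_mono_ex1) auto
  then show False
    using flow[of S] by (auto simp: S_def)
qed

section \<open>Profiles and exchanges that refute optimality\<close>

definition rank :: "'b set \<Rightarrow> 'b rel \<Rightarrow> 'b \<Rightarrow> nat" where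
  "rank Ob r a = card {b \<in> Ob. (a, b) \<in> r}"

text \<open>By transitivity the sets of objects weakly below \<open>a\<close> and \<open>b\<close>
  are nested; if \<open>(a, b) \<notin> r\<close>, the inclusion is proper because \<open>b\<close>
  lies below itself but not below \<open>a\<close>.\<close>

lemma rank_le_iff:
  assumes "finite Ob" "preorder_on Ob r" "total_on Ob r" "a \<in> Ob" "b \<in> Ob"
  shows "rank Ob r b \<le> rank Ob r a \<longleftrightarrow> (a, b) \<in> r"
proof
  have refl: "(c, c) \<in> r" if "c \<in> Ob" for c
    using assms(2) that by (auto simp: preorder_on_def refl_on_def)
  have trans: "trans r"
    using assms(2) by (simp add: preorder_on_def)
  show "rank Ob r b \<le> rank Ob r a" if "(a, b) \<in> r"
    unfolding rank_def using assms(1) that transD[OF trans] by (intro card_mono) auto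
  show "(a, b) \<in> r" if le: "rank Ob r b \<le> rank Ob r a"
  proof (rule ccontr)
    assume no: "(a, b) \<notin> r"
    then have "(b, a) \<in> r"
      using assms(3-5) refl by (cases "a = b") (auto simp: total_on_def)
    then have "rank Ob r a < rank Ob r b"
      unfolding rank_def using assms(1,5) no refl transD[OF trans]
      by (intro psubset_card_mono) auto
    then show False
      using le by simp
  qed
qed

text \<open>The source of all concrete profiles. Since \<open>f\<close> may depend on the agent,
  steep and flat utilities can be combined in one profile.\<close>

lemma rank_utility_profile:
  fixes f :: "'a \<Rightarrow> nat \<Rightarrow> real"
  assumes "finite Ob" "is_preference_profile N Ob R"
    and "\<And>i. strict_mono (f i)" "\<And>i k. f i k > 0"
  shows "(\<lambda>i a. f i (rank Ob (R i) a)) \<in> utility_profiles N Ob R"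
  using assms rank_le_iff[OF assms(1)]
  by (auto simp: utility_profiles_def is_preference_profile_def strict_mono_less_eq)

text \<open>Utilities of \<open>j\<close> at least triple from one rank to a higher one, so
  \<open>y\<close> and \<open>z\<close> together are worth at most two thirds of \<open>x\<close>;
  doubling would only guarantee a tie. The owner \<open>i\<close> of \<open>x\<close> has flat
  utilities, for which two objects outweigh any single one.\<close>

lemma swap_not_necessarily_optimal:
  assumes fin: "finite N" "finite Ob"
    and R: "is_preference_profile N Ob R"
    and p: "is_assignment N Ob p"
    and swap: "has_one_for_two_swap N Ob R p"
  shows "\<not> necessarily_pareto_optimal N Ob R p"
proof -
  obtain j x y z where j: "j \<in> N" and x: "x \<in> Ob" "x \<notin> p j" and yz: "y \<in> p j" "z \<in> p j" "y \<noteq> z"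
    and pref: "(y, x) \<notin> R j" "(z, x) \<notin> R j"
    using swap by (auto simp: has_one_for_two_swap_def)
  obtain i where i: "i \<in> N" "x \<in> p i"
    using p x(1) by (auto simp: is_assignment_def)
  then have ij: "i \<noteq> j"
    using x(2) by auto
  have sub: "p k \<subseteq> Ob" if "k \<in> N" for k
    using p that by (auto simp: is_assignment_def)
  have disj: "p k \<inter> p l = {}" if "k \<in> N" "l \<in> N" "k \<noteq> l" for k l
    using p that by (auto simp: is_assignment_def disjoint_family_on_def)
  have finp: "finite (p k)" if "k \<in> N" for k
    using sub[OF that] fin(2) finite_subset by blast
  \<comment> \<open>\<open>M\<close> exceeds every rank, hence \<open>M + r < 2 * M\<close> for each
    rank \<open>r\<close>: one object is worth less than two.\<close>
  define M where "M = card Ob + 1"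
  define f :: "'a \<Rightarrow> nat \<Rightarrow> real" where "f k r = (if k = j then 3 ^ r else real M + real r)" for k r
  define u where "u k a = f k (rank Ob (R k) a)" for k a
  have "strict_mono (f k)" "f k r > 0" for k r
    by (auto simp: f_def M_def strict_mono_def)
  then have u: "u \<in> utility_profiles N Ob R"
    using rank_utility_profile[OF fin(2) R, of f] unfolding u_def by blast
  define q where "q = p(i := (p i - {x}) \<union> {y, z}, j := insert x (p j - {y, z}))"
  have qi: "q i = (p i - {x}) \<union> {y, z}" and qj: "q j = insert x (p j - {y, z})"
    and q_other: "\<And>k. k \<noteq> i \<Longrightarrow> k \<noteq> j \<Longrightarrow> q k = p k"
    using ij by (auto simp: q_def)
  have "is_assignment N Ob q"
    unfolding is_assignment_def
  proof
    have "o' \<in> (\<Union>k\<in>N. q k)" if o': "o' \<in> Ob" for o'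
    proof -
      obtain k where k: "k \<in> N" "o' \<in> p k"
        using p o' by (auto simp: is_assignment_def)
      consider "o' = x" | "o' \<in> {y, z}" | "o' \<notin> {x, y, z}"
        by blast
      then show ?thesis
      proof cases
        case 3
        then have "o' \<in> q k"
          using k(2) qi qj q_other[of k] by (cases "k = i"; cases "k = j") auto
        then show ?thesis
          using k(1) by blast
      qed (use i(1) j qi qj in auto)
    qed
    moreover have "q k \<subseteq> Ob" if "k \<in> N" for k
      using sub[OF i(1)] sub[OF j] sub[OF that] yz x(1) qi qj q_other[of k]
      by (cases "k = i"; cases "k = j") auto
    ultimately show "(\<Union>k\<in>N. q k) = Ob"
      by blast
    show "disjoint_family_on q N"
      unfolding disjoint_family_on_def
    proof (intro ballI impI)
      fix k l
      assume kl: "k \<in> N" "l \<in> N" "k \<noteq> l"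
      have "x \<notin> p k'" if "k' \<in> N" "k' \<noteq> i" for k'
        using disj[OF that(1) i(1) that(2)] i(2) by auto
      moreover have "y \<notin> p k'" "z \<notin> p k'" if "k' \<in> N" "k' \<noteq> j" for k'
        using disj[OF that(1) j that(2)] yz by auto
      moreover have "x \<noteq> y" "x \<noteq> z"
        using x(2) yz by auto
      ultimately show "q k \<inter> q l = {}"
        using disj[OF kl] kl unfolding q_def by (auto simp: x(2))
    qed
  qed
  moreover have gain: "bundle_utility u j (p j) < bundle_utility u j (q j)"
  proof -
    have "sum (u j) (q j) = sum (u j) (p j) - u j y - u j z + u j x"
    proof -
      have "sum (u j) (p j - {y, z}) = sum (u j) (p j) - sum (u j) {y, z}"
        using finp[OF j] yz by (intro sum_diff) auto
      then show ?thesis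
        using finp[OF j] x(2) yz(3) unfolding qj by simp
    qed
    moreover have "3 * u j v \<le> u j x" if v: "v \<in> p j" "(v, x) \<notin> R j" for v
    proof -
      have "\<not> rank Ob (R j) x \<le> rank Ob (R j) v"
        using rank_le_iff[OF fin(2), of "R j" v x] R j v x(1) sub[OF j]
        by (auto simp: is_preference_profile_def)
      then have "(3 :: real) ^ Suc (rank Ob (R j) v) \<le> 3 ^ rank Ob (R j) x"
        by (intro power_increasing) auto
      then show ?thesis
        by (simp add: u_def f_def)
    qed
    then have "3 * u j y \<le> u j x" "3 * u j z \<le> u j x"
      using yz pref by auto
    moreover have "u j x > 0"
      by (simp add: u_def f_def)
    ultimately show ?thesis
      by (simp add: bundle_utility_def)
  qed
  moreover have "bundle_utility u k (p k) \<le> bundle_utility u k (q k)" if "k \<in> N" for k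
  proof -
    consider "k = i" | "k = j" | "k \<noteq> i" "k \<noteq> j"
      by blast
    then show ?thesis
    proof cases
      case 1
      have "y \<notin> p i" "z \<notin> p i"
        using disj[OF i(1) j ij] yz by auto
      then have "sum (u i) (q i) = sum (u i) (p i) - u i x + u i y + u i z"
        using finp[OF i(1)] i(2) yz(3) unfolding qi by (simp add: sum_diff1)
      moreover have "rank Ob (R i) x \<le> card Ob"
        unfolding rank_def using fin(2) by (intro card_mono) auto
      then have "u i x \<le> u i y + u i z"
        using ij by (simp add: u_def f_def M_def)
      ultimately show ?thesis
        using 1 by (simp add: bundle_utility_def)
    next
      case 3
      then show ?thesis
        by (simp add: q_other)
    next
      case 2
      then show ?thesis
        using gain by simp
    qed
  qed
  ultimately show ?thesis
    using u j unfolding necessarily_pareto_optimal_def pareto_optimal_def pareto_dominates_def by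
        blast
qed

text \<open>Utilities are compared term by term along \<open>\<pi>\<close>, which works for every
  consistent \<open>u\<close>; the improving edge at \<open>x\<close> makes the owner of
  \<open>\<pi> x\<close> gain strictly.\<close>

lemma shift_dominates:
  assumes fin: "finite N" "finite Ob"
    and p: "is_assignment N Ob p"
    and u: "u \<in> utility_profiles N Ob R"
    and \<pi>: "bij_betw \<pi> Ob Ob" "\<And>a. a \<in> Ob \<Longrightarrow> (a, \<pi> a) \<in> acceptable_moves N Ob R p"
    and x: "(x, \<pi> x) \<in> improving_moves N Ob R p"
  shows "\<not> pareto_optimal N Ob u p"
proof -
  \<comment> \<open>Object \<open>a\<close> goes to the owner of \<open>\<pi> a\<close>, so
    \<open>\<pi>\<close> maps the new bundle of \<open>k\<close> bijectively onto the old
    one.\<close>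
  define q where "q k = {a \<in> Ob. \<pi> a \<in> p k}" for k
  have sub: "p k \<subseteq> Ob" if "k \<in> N" for k
    using p that by (auto simp: is_assignment_def)
  have own: "i = k" if "i \<in> N" "k \<in> N" "a \<in> p i" "a \<in> p k" for i k a
    using p that by (auto simp: is_assignment_def disjoint_family_on_def)
  have u_iff: "u j b \<le> u j a \<longleftrightarrow> (a, b) \<in> R j" if "j \<in> N" "a \<in> Ob" "b \<in> Ob" for j a b
    using u that by (auto simp: utility_profiles_def)
  have \<pi>_Ob: "\<pi> a \<in> Ob" if "a \<in> Ob" for a
    using \<pi>(1) that by (auto dest: bij_betwE)
  have "is_assignment N Ob q"
    unfolding is_assignment_def
  proof
    show "(\<Union>k\<in>N. q k) = Ob"
      using \<pi>_Ob p by (fastforce simp: q_def is_assignment_def)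
    show "disjoint_family_on q N"
      using own by (auto simp: disjoint_family_on_def q_def)
  qed
  moreover have bij: "bij_betw \<pi> (q k) (p k)" if "k \<in> N" for k
    using \<pi>(1) sub[OF that] by (auto simp: bij_betw_def q_def intro: inj_on_subset)
  have le: "u k (\<pi> a) \<le> u k a" if "k \<in> N" "a \<in> q k" for k a
  proof -
    have a: "a \<in> Ob" "\<pi> a \<in> p k"
      using that by (auto simp: q_def)
    then obtain i where "i \<in> N" "\<pi> a \<in> p i" "(a, \<pi> a) \<in> R i"
      using \<pi>(2)[OF a(1)] by (auto simp: acceptable_moves_def)
    then have "(a, \<pi> a) \<in> R k"
      using own[of i k] a that by auto
    then show ?thesis
      using u_iff[OF that(1) a(1) \<pi>_Ob[OF a(1)]] by simp
  qed
  have eq: "bundle_utility u k (p k) = (\<Sum>a\<in>q k. u k (\<pi> a))" if "k \<in> N" for k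
    unfolding bundle_utility_def using sum.reindex_bij_betw[OF bij[OF that], of "u k"] by simp
  have "bundle_utility u k (p k) \<le> bundle_utility u k (q k)" if "k \<in> N" for k
    unfolding eq[OF that] unfolding bundle_utility_def using le[OF that] by (intro sum_mono)
  moreover obtain k where k: "k \<in> N" "x \<in> Ob" "\<pi> x \<in> p k" "(\<pi> x, x) \<notin> R k"
    using x by (auto simp: improving_moves_def)
  have "bundle_utility u k (p k) < bundle_utility u k (q k)"
    unfolding eq[OF k(1)] unfolding bundle_utility_def
  proof (rule sum_strict_mono_ex1)
    show "finite (q k)"
      using fin(2) by (auto simp: q_def)
    show "\<exists>a\<in>q k. u k (\<pi> a) < u k a"
      using k u_iff[OF k(1) \<pi>_Ob[OF k(2)] k(2)] by (intro bexI[of _ x]) (auto simp: q_def)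
  qed (use le[OF k(1)] in auto)
  ultimately show ?thesis
    using k(1) unfolding pareto_optimal_def pareto_dominates_def by blast
qed

text \<open>Cutting out the segment between two visits of the same vertex would shorten a path of
  least length. Injectivity is what later turns a cycle into a permutation of the objects.\<close>

lemma shortest_path:
  assumes "(a, b) \<in> r\<^sup>*"
  obtains f and n :: nat where "f 0 = a" "f n = b" "\<And>i. i < n \<Longrightarrow> (f i, f (Suc i)) \<in> r" "inj_on f
      {..n}"
proof -
  define n where "n = (LEAST n. (a, b) \<in> r ^^ n)"
  have "\<exists>n. (a, b) \<in> r ^^ n"
    using assms by (simp add: rtrancl_power)
  then have n: "(a, b) \<in> r ^^ n"
    unfolding n_def by (rule LeastI_ex)
  then obtain f where f: "f 0 = a" "f n = b" "\<And>i. i < n \<Longrightarrow> (f i, f (Suc i)) \<in> r"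
    by (auto simp: relpow_fun_conv)
  have "f i \<noteq> f k" if "i < k" "k \<le> n" for i k
  proof
    assume eq: "f i = f k"
    have "(a, f i) \<in> r ^^ i"
      using f that by (auto simp: relpow_fun_conv intro!: exI[of _ f])
    moreover have "(f k, b) \<in> r ^^ (n - k)"
      using f that by (auto simp: relpow_fun_conv intro!: exI[of _ "\<lambda>l. f (k + l)"])
    ultimately have "(a, b) \<in> r ^^ (i + (n - k))"
      using eq by (auto simp: relpow_add)
    then have "n \<le> i + (n - k)"
      unfolding n_def by (rule Least_le)
    then show False
      using that by simp
  qed
  then have "inj_on f {..n}"
    by (intro inj_onI) (metis atMost_iff nat_neq_iff)
  with f show thesis
    by (rule that)
qed

lemma cycle_not_necessarily_optimal:
  assumes fin: "finite N" "finite Ob"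
    and R: "is_preference_profile N Ob R"
    and p: "is_assignment N Ob p"
    and cycle: "has_improving_cycle N Ob R p"
  shows "\<not> necessarily_pareto_optimal N Ob R p"
proof -
  define E where "E = acceptable_moves N Ob R p"
  obtain x y where xy: "(x, y) \<in> improving_moves N Ob R p" "(y, x) \<in> E\<^sup>*"
    using cycle by (auto simp: has_improving_cycle_def E_def dest: trancl_into_rtrancl)
  obtain f n where f: "f 0 = y" "f n = x" "\<And>i. i < n \<Longrightarrow> (f i, f (Suc i)) \<in> E" "inj_on f {..n}"
    using shortest_path[OF xy(2)] by blast
  have xy_E: "(x, y) \<in> E"
    using xy(1) by (auto simp: E_def improving_moves_def acceptable_moves_def)
  have E_Ob: "a \<in> Ob" "b \<in> Ob" if "(a, b) \<in> E" for a b
    using that p by (auto simp: E_def acceptable_moves_def is_assignment_def)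
  have f_Ob: "f i \<in> Ob" if "i \<le> n" for i
    using that f(2) f(3)[of i] E_Ob xy_E by (cases "i = n") auto
  \<comment> \<open>Cyclic successor of indices. The wrap from \<open>n\<close> to 0 is the closing
    edge from \<open>x\<close> to \<open>y\<close>, which is the improving one.\<close>
  define c where "c i = (if i = n then 0 else Suc i)" for i
  have c_le: "c i \<le> n" if "i \<le> n" for i
    using that by (auto simp: c_def)
  have c_E: "(f i, f (c i)) \<in> E" if "i \<le> n" for i
    using that f(1-3) xy_E by (auto simp: c_def)
  have c_inj: "inj_on c {..n}"
    by (auto simp: inj_on_def c_def)
  \<comment> \<open>Objects off the cycle stay in place; reflexivity of the preferences makes
    \<open>(a, a)\<close> a move.\<close>
  define \<pi> where "\<pi> a = (if a \<in> f ` {..n} then f (c (inv_into {..n} f a)) else a)" for a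
  have \<pi>_f: "\<pi> (f i) = f (c i)" if "i \<le> n" for i
    using that f(4) by (simp add: \<pi>_def)
  have \<pi>_E: "(a, \<pi> a) \<in> E" if "a \<in> Ob" for a
  proof (cases "a \<in> f ` {..n}")
    case True
    then show ?thesis
      using \<pi>_f c_E by auto
  next
    case False
    have "(a, a) \<in> E"
      using that R p
      by (force simp: E_def acceptable_moves_def is_assignment_def is_preference_profile_def
          preorder_on_def refl_on_def)
    then show ?thesis
      using False by (simp add: \<pi>_def)
  qed
  have "inj_on \<pi> Ob"
  proof (rule inj_onI)
    fix a b
    assume eq: "\<pi> a = \<pi> b"
    have image: "\<pi> d \<in> f ` {..n} \<longleftrightarrow> d \<in> f ` {..n}" for d
      using \<pi>_f c_le by (cases "d \<in> f ` {..n}") (auto simp: \<pi>_def)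
    show "a = b"
    proof (cases "a \<in> f ` {..n}")
      case True
      then obtain i k where i: "i \<le> n" "a = f i" "k \<le> n" "b = f k"
        using image[of a] image[of b] eq by auto
      then have "f (c i) = f (c k)"
        using eq \<pi>_f by simp
      then have "c i = c k"
        using f(4) i(1,3) c_le by (auto dest: inj_onD)
      then show ?thesis
        using c_inj i by (auto dest: inj_onD)
    next
      case False
      then have "b \<notin> f ` {..n}"
        using image[of a] image[of b] eq by simp
      then show ?thesis
        using False eq by (simp add: \<pi>_def)
    qed
  qed
  moreover have "\<pi> ` Ob \<subseteq> Ob"
    using \<pi>_E E_Ob by blast
  ultimately have "bij_betw \<pi> Ob Ob"
    using fin(2) by (simp add: bij_betw_def endo_inj_surj)
  moreover have "(x, \<pi> x) \<in> improving_moves N Ob R p"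
    using xy(1) \<pi>_f[of n] f(1,2) by (simp add: c_def)
  \<comment> \<open>Any consistent profile serves here; the summand 1 makes the function of the rank
    positive at 0 as well.\<close>
  moreover have u: "(\<lambda>i a. 1 + real (rank Ob (R i) a)) \<in> utility_profiles N Ob R"
    using rank_utility_profile[OF fin(2) R, of "\<lambda>i k. 1 + real k"] by (simp add: strict_mono_def)
  ultimately have "\<not> pareto_optimal N Ob (\<lambda>i a. 1 + real (rank Ob (R i) a)) p"
    using \<pi>_E by (intro shift_dominates[OF fin p u]) (auto simp: E_def)
  then show ?thesis
    using u unfolding necessarily_pareto_optimal_def by blast
qed

text \<open>Replaces the quantification over all real-valued profiles by ordinal conditions that a
  finite search can check.\<close>

theorem necessarily_pareto_optimal_iff:
  assumes "finite N" "finite Ob" "is_preference_profile N Ob R" "is_assignment N Ob p"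
  shows "necessarily_pareto_optimal N Ob R p \<longleftrightarrow>
    \<not> has_improving_cycle N Ob R p \<and> \<not> has_one_for_two_swap N Ob R p"
  using no_domination[OF assms] swap_not_necessarily_optimal[OF assms]
      cycle_not_necessarily_optimal[OF assms]
  unfolding necessarily_pareto_optimal_def pareto_optimal_def by blast


section \<open>Step counts of machine programs\<close>

text \<open>Addresses are register contents, so the bound on registers limits the cost of addressing
  too.\<close>

definition bits_le :: "state \<Rightarrow> nat \<Rightarrow> bool" where
  "bits_le s B \<longleftrightarrow> (\<forall>r. fst s r < 2 ^ B) \<and> (\<forall>a. snd s a < 2 ^ B)"

text \<open>
  \<open>k\<close> counts unit steps (\<open>Const r k\<close> counts as \<open>Suc k\<close>).  One step lengthens numbers by at most one
  bit, so a polynomial bound on \<open>k\<close> alone bounds the logarithmic cost polynomially.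
\<close>

definition runs :: "com \<Rightarrow> state \<Rightarrow> nat \<Rightarrow> state \<Rightarrow> bool" where
  "runs c s k s' \<longleftrightarrow>
    (\<forall>B. bits_le s B \<longrightarrow> (\<exists>t. exec c s t s' \<and> t \<le> k * (2 * (B + k) + 2) \<and> bits_le s' (B + k)))"

lemma lcost_le: "x < 2 ^ B \<Longrightarrow> lcost x \<le> Suc B"
  by (simp add: lcost_def floorlog_leI)

lemma bits_le_mono:
  assumes "bits_le s B" and "B \<le> B'"
  shows "bits_le s B'"
proof -
  have "(2 :: nat) ^ B \<le> 2 ^ B'"
    using assms(2) by simp
  then show ?thesis
    using assms(1) less_le_trans unfolding bits_le_def by blast
qed

lemma runs_mono:
  assumes "runs c s k s'" and "k \<le> k'"
  shows "runs c s k' s'"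
  unfolding runs_def
proof (intro allI impI)
  fix B
  assume "bits_le s B"
  then obtain t where "exec c s t s'" "t \<le> k * (2 * (B + k) + 2)" "bits_le s' (B + k)"
    using assms(1) unfolding runs_def by blast
  moreover have "k * (2 * (B + k) + 2) \<le> k' * (2 * (B + k') + 2)"
    using assms(2) by (intro mult_le_mono) auto
  ultimately show "\<exists>t. exec c s t s' \<and> t \<le> k' * (2 * (B + k') + 2) \<and> bits_le s' (B + k')"
    using assms(2) bits_le_mono[of s' "B + k" "B + k'"] by (auto intro: order_trans)
qed

text \<open>\<open>k < 2 ^ k\<close> is the crude bound on the length of the constant, whence the
  charge \<open>Suc k\<close>. Constants are part of the program text, so this charge does not
  depend on the input.\<close>

lemma runs_Const: "runs (Const r k) (\<rho>, \<mu>) (Suc k) (\<rho>(r := k), \<mu>)"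
  unfolding runs_def
proof (intro allI impI)
  fix B
  assume B: "bits_le (\<rho>, \<mu>) B"
  have k: "k < 2 ^ (B + Suc k)"
    by (rule less_le_trans[OF less_exp]) (rule power_increasing; simp)
  have "lcost k \<le> Suc (B + Suc k)"
    using k by (rule lcost_le)
  moreover have "bits_le (\<rho>(r := k), \<mu>) (B + Suc k)"
    using bits_le_mono[OF B, of "B + Suc k"] k by (simp add: bits_le_def)
  ultimately show "\<exists>t. exec (Const r k) (\<rho>, \<mu>) t (\<rho>(r := k), \<mu>)
      \<and> t \<le> Suc k * (2 * (B + Suc k) + 2) \<and> bits_le (\<rho>(r := k), \<mu>) (B + Suc k)"
    by (intro exI[of _ "lcost k"]) (auto intro: exec.Const simp: algebra_simps)
qed

lemma runs_Add: "runs (Add r x y) (\<rho>, \<mu>) 1 (\<rho>(r := \<rho> x + \<rho> y), \<mu>)"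
  unfolding runs_def
proof (intro allI impI)
  fix B
  assume B: "bits_le (\<rho>, \<mu>) B"
  then have xy: "\<rho> x < 2 ^ B" "\<rho> y < 2 ^ B"
    by (auto simp: bits_le_def)
  then have "bits_le (\<rho>(r := \<rho> x + \<rho> y), \<mu>) (B + 1)"
    using bits_le_mono[OF B, of "B + 1"] by (auto simp: bits_le_def)
  then show "\<exists>t. exec (Add r x y) (\<rho>, \<mu>) t (\<rho>(r := \<rho> x + \<rho> y), \<mu>)
      \<and> t \<le> 1 * (2 * (B + 1) + 2) \<and> bits_le (\<rho>(r := \<rho> x + \<rho> y), \<mu>) (B + 1)"
    using lcost_le[OF xy(1)] lcost_le[OF xy(2)]
    by (intro exI[of _ "lcost (\<rho> x) + lcost (\<rho> y)"]) (auto intro: exec.Add)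
qed

lemma runs_Sub: "runs (Sub r x y) (\<rho>, \<mu>) 1 (\<rho>(r := \<rho> x - \<rho> y), \<mu>)"
  unfolding runs_def
proof (intro allI impI)
  fix B
  assume B: "bits_le (\<rho>, \<mu>) B"
  then have xy: "\<rho> x < 2 ^ B" "\<rho> y < 2 ^ B"
    by (auto simp: bits_le_def)
  then have "bits_le (\<rho>(r := \<rho> x - \<rho> y), \<mu>) (B + 1)"
    using bits_le_mono[OF B, of "B + 1"] by (auto simp: bits_le_def)
  then show "\<exists>t. exec (Sub r x y) (\<rho>, \<mu>) t (\<rho>(r := \<rho> x - \<rho> y), \<mu>)
      \<and> t \<le> 1 * (2 * (B + 1) + 2) \<and> bits_le (\<rho>(r := \<rho> x - \<rho> y), \<mu>) (B + 1)"
    using lcost_le[OF xy(1)] lcost_le[OF xy(2)]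
    by (intro exI[of _ "lcost (\<rho> x) + lcost (\<rho> y)"]) (auto intro: exec.Sub)
qed

lemma runs_Load: "runs (Load r x) (\<rho>, \<mu>) 1 (\<rho>(r := \<mu> (\<rho> x)), \<mu>)"
  unfolding runs_def
proof (intro allI impI)
  fix B
  assume B: "bits_le (\<rho>, \<mu>) B"
  then have xy: "\<rho> x < 2 ^ B" "\<mu> (\<rho> x) < 2 ^ B"
    by (auto simp: bits_le_def)
  then have "bits_le (\<rho>(r := \<mu> (\<rho> x)), \<mu>) (B + 1)"
    using bits_le_mono[OF B, of "B + 1"] by (auto simp: bits_le_def)
  then show "\<exists>t. exec (Load r x) (\<rho>, \<mu>) t (\<rho>(r := \<mu> (\<rho> x)), \<mu>)
      \<and> t \<le> 1 * (2 * (B + 1) + 2) \<and> bits_le (\<rho>(r := \<mu> (\<rho> x)), \<mu>) (B + 1)"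
    using lcost_le[OF xy(1)] lcost_le[OF xy(2)]
    by (intro exI[of _ "lcost (\<rho> x) + lcost (\<mu> (\<rho> x))"]) (auto intro: exec.Load)
qed

lemma runs_Store: "runs (Store x y) (\<rho>, \<mu>) 1 (\<rho>, \<mu>(\<rho> x := \<rho> y))"
  unfolding runs_def
proof (intro allI impI)
  fix B
  assume B: "bits_le (\<rho>, \<mu>) B"
  then have xy: "\<rho> x < 2 ^ B" "\<rho> y < 2 ^ B"
    by (auto simp: bits_le_def)
  then have "bits_le (\<rho>, \<mu>(\<rho> x := \<rho> y)) (B + 1)"
    using bits_le_mono[OF B, of "B + 1"] by (auto simp: bits_le_def)
  then show "\<exists>t. exec (Store x y) (\<rho>, \<mu>) t (\<rho>, \<mu>(\<rho> x := \<rho> y))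
      \<and> t \<le> 1 * (2 * (B + 1) + 2) \<and> bits_le (\<rho>, \<mu>(\<rho> x := \<rho> y)) (B + 1)"
    using lcost_le[OF xy(1)] lcost_le[OF xy(2)]
    by (intro exI[of _ "lcost (\<rho> x) + lcost (\<rho> y)"]) (auto intro: exec.Store)
qed

text \<open>The second program starts on numbers of \<open>B + k1\<close> bits. Both bounds are
  raised to the final length \<open>B + k1 + k2\<close>.\<close>

lemma runs_bound_add:
  fixes B :: nat
  assumes "t1 \<le> k1 * (2 * (B + k1) + 2)" and "t2 \<le> k2 * (2 * (B + k1 + k2) + 2)"
  shows "t1 + t2 \<le> (k1 + k2) * (2 * (B + (k1 + k2)) + 2)"
proof -
  have "k1 * (2 * (B + k1) + 2) \<le> k1 * (2 * (B + (k1 + k2)) + 2)"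
    by (intro mult_le_mono) auto
  then have "t1 \<le> k1 * (2 * (B + (k1 + k2)) + 2)"
    using assms(1) by (rule order_trans[rotated])
  moreover have "t2 \<le> k2 * (2 * (B + (k1 + k2)) + 2)"
    using assms(2) by (simp only: add.assoc)
  ultimately show ?thesis
    unfolding add_mult_distrib by (rule add_mono)
qed

lemma runs_Seq:
  assumes "runs c1 s k1 s'" and "runs c2 s' k2 s''"
  shows "runs (Seq c1 c2) s (k1 + k2) s''"
  unfolding runs_def
proof (intro allI impI)
  fix B
  assume "bits_le s B"
  then obtain t1 where 1: "exec c1 s t1 s'" "t1 \<le> k1 * (2 * (B + k1) + 2)" "bits_le s' (B + k1)"
    using assms(1) unfolding runs_def by blast
  then obtain t2 where 2: "exec c2 s' t2 s''" "t2 \<le> k2 * (2 * (B + k1 + k2) + 2)"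
      "bits_le s'' (B + k1 + k2)"
    using assms(2) unfolding runs_def by blast
  show "\<exists>t. exec (Seq c1 c2) s t s'' \<and> t \<le> (k1 + k2) * (2 * (B + (k1 + k2)) + 2)
      \<and> bits_le s'' (B + (k1 + k2))"
    using exec.Seq[OF 1(1) 2(1)] runs_bound_add[OF 1(2) 2(2)] 2(3) by (auto simp: add.assoc)
qed

text \<open>Testing a register costs no more than one unit step. Leaving \<open>c'\<close> abstract
  covers both branches of \<open>If\<close> and the unfolding of \<open>While\<close> into body and
  remaining loop.\<close>

lemma runs_test:
  assumes c: "runs c (\<rho>, \<mu>) k s'"
    and c': "\<And>t. exec c (\<rho>, \<mu>) t s' \<Longrightarrow> exec c' (\<rho>, \<mu>) (lcost (\<rho> x) + t) s'"
  shows "runs c' (\<rho>, \<mu>) (Suc k) s'"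
  unfolding runs_def
proof (intro allI impI)
  fix B
  assume B: "bits_le (\<rho>, \<mu>) B"
  then obtain t where t: "exec c (\<rho>, \<mu>) t s'" "t \<le> k * (2 * (B + k) + 2)" "bits_le s' (B + k)"
    using c unfolding runs_def by blast
  have "lcost (\<rho> x) \<le> 1 * (2 * (B + 1) + 2)"
    using lcost_le[of "\<rho> x" B] B by (auto simp: bits_le_def)
  moreover have "t \<le> k * (2 * (B + 1 + k) + 2)"
    by (rule order_trans[OF t(2)]) simp
  ultimately have "lcost (\<rho> x) + t \<le> (1 + k) * (2 * (B + (1 + k)) + 2)"
    by (rule runs_bound_add)
  then show "\<exists>t. exec c' (\<rho>, \<mu>) t s' \<and> t \<le> Suc k * (2 * (B + Suc k) + 2) \<and> bits_le s' (B + Suc k)"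
    using c'[OF t(1)] bits_le_mono[OF t(3), of "B + Suc k"] by auto
qed

lemma runs_IfNonzero:
  "\<rho> x \<noteq> 0 \<Longrightarrow> runs c1 (\<rho>, \<mu>) k s' \<Longrightarrow> runs (com.If x c1 c2) (\<rho>, \<mu>) (Suc k) s'"
  by (erule runs_test) (rule exec.IfNonzero)

lemma runs_IfZero:
  "\<rho> x = 0 \<Longrightarrow> runs c2 (\<rho>, \<mu>) k s' \<Longrightarrow> runs (com.If x c1 c2) (\<rho>, \<mu>) (Suc k) s'"
  by (erule runs_test) (rule exec.IfZero)

lemma runs_WhileZero:
  assumes "\<rho> x = 0"
  shows "runs (While x c) (\<rho>, \<mu>) 1 (\<rho>, \<mu>)"
  unfolding runs_def
proof (intro allI impI)
  fix B
  assume B: "bits_le (\<rho>, \<mu>) B"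
  then have "lcost (\<rho> x) \<le> Suc B"
    by (intro lcost_le) (auto simp: bits_le_def)
  then show "\<exists>t. exec (While x c) (\<rho>, \<mu>) t (\<rho>, \<mu>) \<and> t \<le> 1 * (2 * (B + 1) + 2)
      \<and> bits_le (\<rho>, \<mu>) (B + 1)"
    using exec.WhileZero[of \<rho> x c \<mu>] assms bits_le_mono[OF B, of "B + 1"]
    by (intro exI[of _ "lcost (\<rho> x)"]) auto
qed

lemma runs_WhileNonzero:
  assumes "\<rho> x \<noteq> 0" and "runs c (\<rho>, \<mu>) k1 s'" and "runs (While x c) s' k2 s''"
  shows "runs (While x c) (\<rho>, \<mu>) (Suc (k1 + k2)) s''"
proof (rule runs_test)
  show "runs (Seq c (While x c)) (\<rho>, \<mu>) (k1 + k2) s''"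
    using assms(2,3) by (rule runs_Seq)
  show "exec (While x c) (\<rho>, \<mu>) (lcost (\<rho> x) + t) s''"
    if "exec (Seq c (While x c)) (\<rho>, \<mu>) t s''" for t
    using that
  proof (rule SeqE)
    fix t1 r t2
    assume *: "t = t1 + t2" "exec c (\<rho>, \<mu>) t1 r" "exec (While x c) r t2 s''"
    show ?thesis
      using exec.WhileNonzero[OF assms(1) *(2,3)] *(1) by (simp add: add.assoc)
  qed
qed

text \<open>The machine tests only against zero, so a second counter \<open>x + 1\<close> runs
  downwards while the loop variable \<open>x\<close> runs upwards. Register \<open>x + 2\<close> is
  reloaded with 1 in every round, as the body may overwrite it.\<close>

definition count_loop :: "reg \<Rightarrow> reg \<Rightarrow> com \<Rightarrow> com" where
  "count_loop x b c =
    Seq (Const x 0) (Seq (Const (x + 1) 0) (Seq (Add (x + 1) (x + 1) b)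
      (While (x + 1) (Seq c (Seq (Const (x + 2) 1) (Seq (Add x x (x + 2)) (Sub (x + 1) (x + 1) (x
          + 2))))))))"

text \<open>Each round costs \<open>k\<close> for the body, 2 for \<open>Const\<close>, 1 each for
  \<open>Add\<close>, \<open>Sub\<close> and the test; the 4 extra steps are three initialisations
  and the last test. By \<open>stable\<close>, the invariant \<open>J\<close> survives every change
  of the bookkeeping registers.\<close>

lemma runs_count_loop:
  assumes body: "\<And>i \<rho> \<mu>. \<lbrakk>i < n; J i \<rho> \<mu>; \<rho> x = i\<rbrakk> \<Longrightarrow>
      \<exists>\<rho>' \<mu>'. runs c (\<rho>, \<mu>) k (\<rho>', \<mu>') \<and> \<rho>' x = i \<and> \<rho>' (x + 1) = \<rho> (x + 1) \<and> J (Suc i) \<rho>' \<mu>'"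
    and stable: "\<And>i \<rho> \<mu> v w z. J i \<rho> \<mu> \<Longrightarrow> J i (\<rho>(x := v, x + 1 := w, x + 2 := z)) \<mu>"
    and init: "J 0 \<rho> \<mu>" "\<rho> b = n" "b < x"
  shows "\<exists>\<rho>' \<mu>'. runs (count_loop x b c) (\<rho>, \<mu>) (4 + n * (k + 5)) (\<rho>', \<mu>') \<and> J n \<rho>' \<mu>'"
proof -
  define w where "w = Seq c (Seq (Const (x + 2) 1) (Seq (Add x x (x + 2)) (Sub (x + 1) (x + 1) (x
      + 2))))"
  have loop: "\<exists>\<rho>' \<mu>'. runs (While (x + 1) w) (\<rho>, \<mu>) (1 + (n - i) * (k + 5)) (\<rho>', \<mu>') \<and> J n \<rho>' \<mu>'"
    if "i \<le> n" "J i \<rho> \<mu>" "\<rho> x = i" "\<rho> (x + 1) = n - i" for i \<rho> \<mu>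
    using that
  proof (induction "n - i" arbitrary: i \<rho> \<mu>)
    case 0
    then show ?case
      using runs_WhileZero[of \<rho> "x + 1" w \<mu>] by (intro exI[of _ \<rho>] exI[of _ \<mu>]) auto
  next
    case (Suc l)
    have "i < n"
      using Suc.hyps(2) by simp
    then obtain \<rho>1 \<mu>1 where 1: "runs c (\<rho>, \<mu>) k (\<rho>1, \<mu>1)" "\<rho>1 x = i"
        "\<rho>1 (x + 1) = \<rho> (x + 1)" "J (Suc i) \<rho>1 \<mu>1"
      using body[OF _ Suc.prems(2,3)] by blast
    define \<rho>2 where "\<rho>2 = \<rho>1(x := Suc i, x + 1 := n - Suc i, x + 2 := 1)"
    define \<rho>3 where "\<rho>3 = \<rho>1(x + 2 := 1)"
    define \<rho>4 where "\<rho>4 = \<rho>3(x := \<rho>3 x + \<rho>3 (x + 2))"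
    have "\<rho>4(x + 1 := \<rho>4 (x + 1) - \<rho>4 (x + 2)) = \<rho>2"
      using 1(2,3) Suc.prems(4) unfolding \<rho>2_def \<rho>3_def \<rho>4_def by auto
    then have "runs w (\<rho>, \<mu>) (k + (2 + (1 + 1))) (\<rho>2, \<mu>1)"
      unfolding w_def
      using runs_Const[of "x + 2" 1 \<rho>1 \<mu>1, folded \<rho>3_def]
        runs_Add[of x x "x + 2" \<rho>3 \<mu>1, folded \<rho>4_def]
        runs_Sub[of "x + 1" "x + 1" "x + 2" \<rho>4 \<mu>1]
      by (intro runs_Seq[OF 1(1)] runs_Seq) (auto simp: numeral_2_eq_2)
    moreover have "J (Suc i) \<rho>2 \<mu>1"
      unfolding \<rho>2_def using 1(4) by (rule stable)
    then have "\<exists>\<rho>' \<mu>'. runs (While (x + 1) w) (\<rho>2, \<mu>1) (1 + (n - Suc i) * (k + 5)) (\<rho>', \<mu>') \<and> J n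
        \<rho>' \<mu>'"
      using \<open>i < n\<close> Suc.hyps(2) by (intro Suc.hyps(1)) (auto simp: \<rho>2_def)
    then obtain \<rho>' \<mu>' where 2: "runs (While (x + 1) w) (\<rho>2, \<mu>1) (1 + (n - Suc i) * (k + 5)) (\<rho>',
        \<mu>')"
      "J n \<rho>' \<mu>'" by blast
    moreover have "\<rho> (x + 1) \<noteq> 0"
      using Suc.prems(4) \<open>i < n\<close> by simp
    ultimately have "runs (While (x + 1) w) (\<rho>, \<mu>)
        (Suc (k + (2 + (1 + 1)) + (1 + (n - Suc i) * (k + 5)))) (\<rho>', \<mu>')"
      by (intro runs_WhileNonzero)
    moreover have "Suc (k + (2 + (1 + 1)) + (1 + (n - Suc i) * (k + 5))) = 1 + (n - i) * (k + 5)"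
    proof -
      have "n - i = Suc (n - Suc i)" using \<open>i < n\<close> by simp
      then show ?thesis by simp
    qed
    ultimately show ?case
      using 2(2) by metis
  qed
  define \<rho>0 where "\<rho>0 = \<rho>(x := 0, x + 1 := 0)"
  have \<rho>0: "\<rho>0(x + 1 := \<rho>0 (x + 1) + \<rho>0 b) = \<rho>(x := 0, x + 1 := n, x + 2 := \<rho> (x + 2))"
    using init(2,3) by (auto simp: \<rho>0_def)
  obtain \<rho>' \<mu>' where *: "runs (While (x + 1) w) (\<rho>0(x + 1 := \<rho>0 (x + 1) + \<rho>0 b), \<mu>) (1 + n * (k +
      5)) (\<rho>', \<mu>')"
    "J n \<rho>' \<mu>'"
    using loop[of 0 "\<rho>0(x + 1 := \<rho>0 (x + 1) + \<rho>0 b)" \<mu>] stable[OF init(1), of 0 n "\<rho> (x + 2)"]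
    unfolding \<rho>0 by auto
  have "runs (count_loop x b c) (\<rho>, \<mu>) (1 + (1 + (1 + (1 + n * (k + 5))))) (\<rho>', \<mu>')"
    unfolding count_loop_def w_def[symmetric]
    by (rule runs_Seq[OF runs_Const[of x 0 \<rho> \<mu>, folded One_nat_def]
          runs_Seq[OF runs_Const[of "x + 1" 0 "\<rho>(x := 0)" \<mu>, folded \<rho>0_def One_nat_def]
            runs_Seq[OF runs_Add *(1)]]])
  moreover have "1 + (1 + (1 + (1 + n * (k + 5)))) = 4 + n * (k + 5)"
    by simp
  ultimately show ?thesis
    using *(2) by metis
qed


section \<open>Compilation of bounded sums and loops\<close>

text \<open>
  \<open>SumLt x b e\<close> sums \<open>e\<close> over all \<open>x < n\<close> if \<open>b\<close>, and over all \<open>x < m\<close> otherwise; it also serves as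
  bounded existential quantifier, nonzero values being true.
\<close>

datatype expr =
    Num nat
  | Var nat
  | Plus expr expr
  | Minus expr expr
  | Ite expr expr expr
  | Mem expr
  | SumLt nat bool expr

fun eval :: "nat \<Rightarrow> nat \<Rightarrow> (nat \<Rightarrow> nat) \<Rightarrow> expr \<Rightarrow> (nat \<Rightarrow> nat) \<Rightarrow> nat" where
  "eval n m \<mu> (Num k) \<sigma> = k"
| "eval n m \<mu> (Var x) \<sigma> = \<sigma> x"
| "eval n m \<mu> (Plus e1 e2) \<sigma> = eval n m \<mu> e1 \<sigma> + eval n m \<mu> e2 \<sigma>"
| "eval n m \<mu> (Minus e1 e2) \<sigma> = eval n m \<mu> e1 \<sigma> - eval n m \<mu> e2 \<sigma>"
| "eval n m \<mu> (Ite e1 e2 e3) \<sigma> = (if eval n m \<mu> e1 \<sigma> \<noteq> 0 then eval n m \<mu> e2 \<sigma> else eval n m \<mu> e3 \<sigma>)"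
| "eval n m \<mu> (Mem e) \<sigma> = \<mu> (eval n m \<mu> e \<sigma>)"
| "eval n m \<mu> (SumLt x b e) \<sigma> = (\<Sum>i<(if b then n else m). eval n m \<mu> e (\<sigma>(x := i)))"

text \<open>
  The value is left in register \<open>d\<close>; registers below \<open>d\<close> are preserved, registers 1 and 2 hold \<open>n\<close>
  and \<open>m\<close>, and the variable \<open>x\<close> lives in register \<open>\<eta> x\<close>.
\<close>

fun compile_expr :: "expr \<Rightarrow> (nat \<Rightarrow> reg) \<Rightarrow> reg \<Rightarrow> com" where
  "compile_expr (Num k) \<eta> d = Const d k"
| "compile_expr (Var x) \<eta> d = Seq (Const d 0) (Add d d (\<eta> x))"
| "compile_expr (Plus e1 e2) \<eta> d =
    Seq (compile_expr e1 \<eta> d) (Seq (compile_expr e2 \<eta> (d + 1)) (Add d d (d + 1)))"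
| "compile_expr (Minus e1 e2) \<eta> d =
    Seq (compile_expr e1 \<eta> d) (Seq (compile_expr e2 \<eta> (d + 1)) (Sub d d (d + 1)))"
| "compile_expr (Ite e1 e2 e3) \<eta> d =
    Seq (compile_expr e1 \<eta> d) (com.If d (compile_expr e2 \<eta> d) (compile_expr e3 \<eta> d))"
| "compile_expr (Mem e) \<eta> d = Seq (compile_expr e \<eta> d) (Load d d)"
| "compile_expr (SumLt x b e) \<eta> d =
    Seq (Const d 0) (count_loop (d + 1) (if b then 1 else 2)
      (Seq (compile_expr e (\<eta>(x := d + 1)) (d + 3)) (Add d d (d + 3))))"

text \<open>A polynomial in a common bound \<open>K\<close> of both loop lengths, so
  \<open>[:0, 1:]\<close> stands for the number of rounds. \<open>Ite\<close> pays for both branches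
  because the one taken depends on the input.\<close>

fun expr_cost :: "expr \<Rightarrow> nat poly" where
  "expr_cost (Num k) = [:Suc k:]"
| "expr_cost (Var x) = [:2:]"
| "expr_cost (Plus e1 e2) = expr_cost e1 + expr_cost e2 + 1"
| "expr_cost (Minus e1 e2) = expr_cost e1 + expr_cost e2 + 1"
| "expr_cost (Ite e1 e2 e3) = expr_cost e1 + expr_cost e2 + expr_cost e3 + 1"
| "expr_cost (Mem e) = expr_cost e + 1"
| "expr_cost (SumLt x b e) = [:5:] + [:0, 1:] * (expr_cost e + [:6:])"

text \<open>Register \<open>d\<close> acts as a stack pointer: variables live below it and results
  are built from it upwards, so preserving the registers below \<open>d\<close> keeps the
  environment intact between subexpressions.\<close>

lemma runs_compile_expr:
  assumes "\<And>x. \<eta> x < d" "3 \<le> d" "\<rho> 1 = n" "\<rho> 2 = m" "n \<le> K" "m \<le> K"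
  shows "\<exists>\<rho>'. runs (compile_expr e \<eta> d) (\<rho>, \<mu>) (poly (expr_cost e) K) (\<rho>', \<mu>)
    \<and> \<rho>' d = eval n m \<mu> e (\<rho> \<circ> \<eta>) \<and> (\<forall>r<d. \<rho>' r = \<rho> r)"
  using assms(1-4)
proof (induction e arbitrary: \<eta> d \<rho>)
  case (Num k)
  have "runs (compile_expr (Num k) \<eta> d) (\<rho>, \<mu>) (poly (expr_cost (Num k)) K) (\<rho>(d := k), \<mu>)"
    using runs_Const[of d k \<rho> \<mu>] by simp
  moreover have "(\<rho>(d := k)) d = eval n m \<mu> (Num k) (\<rho> \<circ> \<eta>)" "\<forall>r<d. (\<rho>(d := k)) r = \<rho> r"
    by auto
  ultimately show ?case
    by blast
next
  case (Var x)
  have "runs (compile_expr (Var x) \<eta> d) (\<rho>, \<mu>) (1 + 1) (\<rho>(d := \<rho> (\<eta> x)), \<mu>)"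
    using runs_Seq[OF runs_Const[of d 0 \<rho> \<mu>] runs_Add[of d d "\<eta> x" "\<rho>(d := 0)" \<mu>]]
      Var.prems(1)[of x] by auto
  then have "runs (compile_expr (Var x) \<eta> d) (\<rho>, \<mu>) (poly (expr_cost (Var x)) K) (\<rho>(d := \<rho> (\<eta> x)),
      \<mu>)"
    by (rule runs_mono) simp
  moreover have "(\<rho>(d := \<rho> (\<eta> x))) d = eval n m \<mu> (Var x) (\<rho> \<circ> \<eta>)"
    "\<forall>r<d. (\<rho>(d := \<rho> (\<eta> x))) r = \<rho> r"
    by auto
  ultimately show ?case
    by blast
next
  case (Plus e1 e2)
  obtain \<rho>1 where 1: "runs (compile_expr e1 \<eta> d) (\<rho>, \<mu>) (poly (expr_cost e1) K) (\<rho>1, \<mu>)"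
      "\<rho>1 d = eval n m \<mu> e1 (\<rho> \<circ> \<eta>)" "\<forall>r<d. \<rho>1 r = \<rho> r"
    using Plus.IH(1)[of \<eta> d \<rho>] Plus.prems by blast
  have eq: "\<rho>1 \<circ> \<eta> = \<rho> \<circ> \<eta>"
    using 1(3) Plus.prems(1) by auto
  have \<rho>1: "\<rho>1 1 = n" "\<rho>1 2 = m" "\<And>x. \<eta> x < d + 1" "3 \<le> d + 1"
    using 1(3) Plus.prems by (auto intro: less_SucI)
  obtain \<rho>2 where 2: "runs (compile_expr e2 \<eta> (d + 1)) (\<rho>1, \<mu>) (poly (expr_cost e2) K) (\<rho>2, \<mu>)"
      "\<rho>2 (d + 1) = eval n m \<mu> e2 (\<rho>1 \<circ> \<eta>)" "\<forall>r<d + 1. \<rho>2 r = \<rho>1 r"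
    using Plus.IH(2)[of \<eta> "d + 1" \<rho>1] \<rho>1 by blast
  have "runs (compile_expr (Plus e1 e2) \<eta> d) (\<rho>, \<mu>)
      (poly (expr_cost e1) K + (poly (expr_cost e2) K + 1)) (\<rho>2(d := \<rho>2 d + \<rho>2 (d + 1)), \<mu>)"
    unfolding compile_expr.simps by (intro runs_Seq[OF 1(1)] runs_Seq[OF 2(1)] runs_Add)
  then have "runs (compile_expr (Plus e1 e2) \<eta> d) (\<rho>, \<mu>)
      (poly (expr_cost (Plus e1 e2)) K) (\<rho>2(d := \<rho>2 d + \<rho>2 (d + 1)), \<mu>)"
    by (rule runs_mono) simp
  moreover have "(\<rho>2(d := \<rho>2 d + \<rho>2 (d + 1))) d = eval n m \<mu> (Plus e1 e2) (\<rho> \<circ> \<eta>)"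
    "\<forall>r<d. (\<rho>2(d := \<rho>2 d + \<rho>2 (d + 1))) r = \<rho> r"
    using 1(2,3) 2(2,3) eq by auto
  ultimately show ?case
    by blast
next
  case (Minus e1 e2)
  obtain \<rho>1 where 1: "runs (compile_expr e1 \<eta> d) (\<rho>, \<mu>) (poly (expr_cost e1) K) (\<rho>1, \<mu>)"
      "\<rho>1 d = eval n m \<mu> e1 (\<rho> \<circ> \<eta>)" "\<forall>r<d. \<rho>1 r = \<rho> r"
    using Minus.IH(1)[of \<eta> d \<rho>] Minus.prems by blast
  have eq: "\<rho>1 \<circ> \<eta> = \<rho> \<circ> \<eta>"
    using 1(3) Minus.prems(1) by auto
  have \<rho>1: "\<rho>1 1 = n" "\<rho>1 2 = m" "\<And>x. \<eta> x < d + 1" "3 \<le> d + 1"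
    using 1(3) Minus.prems by (auto intro: less_SucI)
  obtain \<rho>2 where 2: "runs (compile_expr e2 \<eta> (d + 1)) (\<rho>1, \<mu>) (poly (expr_cost e2) K) (\<rho>2, \<mu>)"
      "\<rho>2 (d + 1) = eval n m \<mu> e2 (\<rho>1 \<circ> \<eta>)" "\<forall>r<d + 1. \<rho>2 r = \<rho>1 r"
    using Minus.IH(2)[of \<eta> "d + 1" \<rho>1] \<rho>1 by blast
  have "runs (compile_expr (Minus e1 e2) \<eta> d) (\<rho>, \<mu>)
      (poly (expr_cost e1) K + (poly (expr_cost e2) K + 1)) (\<rho>2(d := \<rho>2 d - \<rho>2 (d + 1)), \<mu>)"
    unfolding compile_expr.simps by (intro runs_Seq[OF 1(1)] runs_Seq[OF 2(1)] runs_Sub)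
  then have "runs (compile_expr (Minus e1 e2) \<eta> d) (\<rho>, \<mu>)
      (poly (expr_cost (Minus e1 e2)) K) (\<rho>2(d := \<rho>2 d - \<rho>2 (d + 1)), \<mu>)"
    by (rule runs_mono) simp
  moreover have "(\<rho>2(d := \<rho>2 d - \<rho>2 (d + 1))) d = eval n m \<mu> (Minus e1 e2) (\<rho> \<circ> \<eta>)"
    "\<forall>r<d. (\<rho>2(d := \<rho>2 d - \<rho>2 (d + 1))) r = \<rho> r"
    using 1(2,3) 2(2,3) eq by auto
  ultimately show ?case
    by blast
next
  case (Ite e1 e2 e3)
  obtain \<rho>1 where 1: "runs (compile_expr e1 \<eta> d) (\<rho>, \<mu>) (poly (expr_cost e1) K) (\<rho>1, \<mu>)"
      "\<rho>1 d = eval n m \<mu> e1 (\<rho> \<circ> \<eta>)" "\<forall>r<d. \<rho>1 r = \<rho> r"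
    using Ite.IH(1)[of \<eta> d \<rho>] Ite.prems by blast
  have eq: "\<rho>1 \<circ> \<eta> = \<rho> \<circ> \<eta>"
    using 1(3) Ite.prems(1) by auto
  have \<rho>1: "\<rho>1 1 = n" "\<rho>1 2 = m"
    using 1(3) Ite.prems by auto
  obtain \<rho>2 where 2: "runs (compile_expr e2 \<eta> d) (\<rho>1, \<mu>) (poly (expr_cost e2) K) (\<rho>2, \<mu>)"
      "\<rho>2 d = eval n m \<mu> e2 (\<rho>1 \<circ> \<eta>)" "\<forall>r<d. \<rho>2 r = \<rho>1 r"
    using Ite.IH(2)[of \<eta> d \<rho>1] Ite.prems(1,2) \<rho>1 by blast
  obtain \<rho>3 where 3: "runs (compile_expr e3 \<eta> d) (\<rho>1, \<mu>) (poly (expr_cost e3) K) (\<rho>3, \<mu>)"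
      "\<rho>3 d = eval n m \<mu> e3 (\<rho>1 \<circ> \<eta>)" "\<forall>r<d. \<rho>3 r = \<rho>1 r"
    using Ite.IH(3)[of \<eta> d \<rho>1] Ite.prems(1,2) \<rho>1 by blast
  show ?case
  proof (cases "\<rho>1 d = 0")
    case True
    have "runs (compile_expr (Ite e1 e2 e3) \<eta> d) (\<rho>, \<mu>)
        (poly (expr_cost e1) K + Suc (poly (expr_cost e3) K)) (\<rho>3, \<mu>)"
      unfolding compile_expr.simps using True
      by (intro runs_Seq[OF 1(1)] runs_IfZero 3(1)) auto
    then have "runs (compile_expr (Ite e1 e2 e3) \<eta> d) (\<rho>, \<mu>) (poly (expr_cost (Ite e1 e2 e3)) K)
        (\<rho>3, \<mu>)"
      by (rule runs_mono) simp
    moreover have "\<rho>3 d = eval n m \<mu> (Ite e1 e2 e3) (\<rho> \<circ> \<eta>)" "\<forall>r<d. \<rho>3 r = \<rho> r"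
      using 1(2,3) 3(2,3) eq True by auto
    ultimately show ?thesis
      by blast
  next
    case False
    have "runs (compile_expr (Ite e1 e2 e3) \<eta> d) (\<rho>, \<mu>)
        (poly (expr_cost e1) K + Suc (poly (expr_cost e2) K)) (\<rho>2, \<mu>)"
      unfolding compile_expr.simps using False
      by (intro runs_Seq[OF 1(1)] runs_IfNonzero 2(1)) auto
    then have "runs (compile_expr (Ite e1 e2 e3) \<eta> d) (\<rho>, \<mu>) (poly (expr_cost (Ite e1 e2 e3)) K)
        (\<rho>2, \<mu>)"
      by (rule runs_mono) simp
    moreover have "\<rho>2 d = eval n m \<mu> (Ite e1 e2 e3) (\<rho> \<circ> \<eta>)" "\<forall>r<d. \<rho>2 r = \<rho> r"
      using 1(2,3) 2(2,3) eq False by auto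
    ultimately show ?thesis
      by blast
  qed
next
  case (Mem e)
  obtain \<rho>1 where 1: "runs (compile_expr e \<eta> d) (\<rho>, \<mu>) (poly (expr_cost e) K) (\<rho>1, \<mu>)"
      "\<rho>1 d = eval n m \<mu> e (\<rho> \<circ> \<eta>)" "\<forall>r<d. \<rho>1 r = \<rho> r"
    using Mem.IH[of \<eta> d \<rho>] Mem.prems by blast
  have "runs (compile_expr (Mem e) \<eta> d) (\<rho>, \<mu>) (poly (expr_cost e) K + 1) (\<rho>1(d := \<mu> (\<rho>1 d)), \<mu>)"
    unfolding compile_expr.simps by (intro runs_Seq[OF 1(1)] runs_Load)
  then have "runs (compile_expr (Mem e) \<eta> d) (\<rho>, \<mu>) (poly (expr_cost (Mem e)) K) (\<rho>1(d := \<mu> (\<rho>1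
      d)), \<mu>)"
    by (rule runs_mono) simp
  moreover have "(\<rho>1(d := \<mu> (\<rho>1 d))) d = eval n m \<mu> (Mem e) (\<rho> \<circ> \<eta>)"
    "\<forall>r<d. (\<rho>1(d := \<mu> (\<rho>1 d))) r = \<rho> r"
    using 1(2,3) by auto
  ultimately show ?case
    by blast
next
  case (SumLt x b e)
  define l where "l = (if b then n else m)"
  \<comment> \<open>Register \<open>d\<close> accumulates the partial sum; \<open>d + 1\<close> to
    \<open>d + 3\<close> serve the loop, the last one also receiving the value of the
    summand.\<close>
  define J where "J i \<rho>' \<mu>' \<longleftrightarrow> \<mu>' = \<mu> \<and> (\<forall>r<d. \<rho>' r = \<rho> r)
    \<and> \<rho>' d = (\<Sum>j<i. eval n m \<mu> e ((\<rho> \<circ> \<eta>)(x := j)))" for i \<rho>' \<mu>'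
  have "\<exists>\<rho>' \<mu>'. runs (count_loop (d + 1) (if b then 1 else 2)
      (Seq (compile_expr e (\<eta>(x := d + 1)) (d + 3)) (Add d d (d + 3)))) (\<rho>(d := 0), \<mu>)
      (4 + l * (poly (expr_cost e) K + 1 + 5)) (\<rho>', \<mu>') \<and> J l \<rho>' \<mu>'"
  proof (rule runs_count_loop)
    show "(\<rho>(d := 0)) (if b then 1 else 2) = l" "(if b then 1 else 2) < d + 1"
      using SumLt.prems(2-4) by (auto simp: l_def)
    show "J 0 (\<rho>(d := 0)) \<mu>"
      by (simp add: J_def)
    show "J i (\<rho>'(d + 1 := v, d + 1 + 1 := w, d + 1 + 2 := z)) \<mu>'" if "J i \<rho>' \<mu>'" for i \<rho>' \<mu>' v w z
      using that by (auto simp: J_def)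
    fix i \<rho>1 \<mu>1
    assume i: "i < l" "J i \<rho>1 \<mu>1" "\<rho>1 (d + 1) = i"
    have \<rho>1: "\<mu>1 = \<mu>" "\<forall>r<d. \<rho>1 r = \<rho> r"
      using i(2) by (auto simp: J_def)
    then have eq: "\<rho>1 \<circ> \<eta>(x := d + 1) = (\<rho> \<circ> \<eta>)(x := i)"
      using SumLt.prems(1) i(3) by auto
    have "\<eta> y < d + 3" for y
      using SumLt.prems(1)[of y] by simp
    then have \<rho>1': "\<And>y. (\<eta>(x := d + 1)) y < d + 3" "\<rho>1 1 = n" "\<rho>1 2 = m" "3 \<le> d + 3"
      using SumLt.prems \<rho>1(2) by auto
    then obtain \<rho>2 where 2: "runs (compile_expr e (\<eta>(x := d + 1)) (d + 3)) (\<rho>1, \<mu>) (poly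
        (expr_cost e) K) (\<rho>2, \<mu>)"
        "\<rho>2 (d + 3) = eval n m \<mu> e ((\<rho> \<circ> \<eta>)(x := i))" "\<forall>r<d + 3. \<rho>2 r = \<rho>1 r"
      using SumLt.IH[of "\<eta>(x := d + 1)" "d + 3" \<rho>1] \<rho>1' unfolding eq by blast
    have "runs (Seq (compile_expr e (\<eta>(x := d + 1)) (d + 3)) (Add d d (d + 3))) (\<rho>1, \<mu>1)
        (poly (expr_cost e) K + 1) (\<rho>2(d := \<rho>2 d + \<rho>2 (d + 3)), \<mu>)"
      unfolding \<rho>1(1) by (intro runs_Seq[OF 2(1)] runs_Add)
    moreover have "J (Suc i) (\<rho>2(d := \<rho>2 d + \<rho>2 (d + 3))) \<mu>"
      using i(2) 2(2,3) by (auto simp: J_def)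
    ultimately show "\<exists>\<rho>' \<mu>'. runs (Seq (compile_expr e (\<eta>(x := d + 1)) (d + 3)) (Add d d (d + 3)))
        (\<rho>1, \<mu>1) (poly (expr_cost e) K + 1) (\<rho>', \<mu>') \<and> \<rho>' (d + 1) = i
        \<and> \<rho>' (d + 1 + 1) = \<rho>1 (d + 1 + 1) \<and> J (Suc i) \<rho>' \<mu>'"
      using 2(3) i(3) by (intro exI[of _ "\<rho>2(d := \<rho>2 d + \<rho>2 (d + 3))"] exI[of _ \<mu>]) auto
  qed
  then obtain \<rho>' \<mu>' where *: "runs (count_loop (d + 1) (if b then 1 else 2)
      (Seq (compile_expr e (\<eta>(x := d + 1)) (d + 3)) (Add d d (d + 3)))) (\<rho>(d := 0), \<mu>)
      (4 + l * (poly (expr_cost e) K + 1 + 5)) (\<rho>', \<mu>')" "J l \<rho>' \<mu>'"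
    by blast
  have "l * (poly (expr_cost e) K + 1 + 5) \<le> K * (poly (expr_cost e) K + 6)"
    using assms(5,6) by (auto simp: l_def intro!: mult_le_mono)
  then have "Suc 0 + (4 + l * (poly (expr_cost e) K + 1 + 5)) \<le> poly (expr_cost (SumLt x b e)) K"
    by (auto simp: algebra_simps)
  with runs_Seq[OF runs_Const *(1)]
  have "runs (compile_expr (SumLt x b e) \<eta> d) (\<rho>, \<mu>) (poly (expr_cost (SumLt x b e)) K) (\<rho>', \<mu>')"
    unfolding compile_expr.simps by (rule runs_mono)
  moreover have "\<mu>' = \<mu>" "\<rho>' d = eval n m \<mu> (SumLt x b e) (\<rho> \<circ> \<eta>)" "\<forall>r<d. \<rho>' r = \<rho> r"
    using *(2) by (simp_all add: J_def l_def)
  ultimately show ?case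
    by blast
qed


section \<open>Loops that write to memory\<close>

datatype stmt =
    StoreAt expr expr
  | For nat bool stmt

fun run :: "nat \<Rightarrow> nat \<Rightarrow> stmt \<Rightarrow> (nat \<Rightarrow> nat) \<Rightarrow> (nat \<Rightarrow> nat) \<Rightarrow> nat \<Rightarrow> nat" where
  "run n m (StoreAt e1 e2) \<sigma> \<mu> = \<mu>(eval n m \<mu> e1 \<sigma> := eval n m \<mu> e2 \<sigma>)"
| "run n m (For x b s) \<sigma> \<mu> = fold (\<lambda>i. run n m s (\<sigma>(x := i))) [0..<(if b then n else m)] \<mu>"

fun compile_stmt :: "stmt \<Rightarrow> (nat \<Rightarrow> reg) \<Rightarrow> reg \<Rightarrow> com" where
  "compile_stmt (StoreAt e1 e2) \<eta> d =
    Seq (compile_expr e1 \<eta> d) (Seq (compile_expr e2 \<eta> (d + 1)) (Store d (d + 1)))"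
| "compile_stmt (For x b s) \<eta> d = count_loop d (if b then 1 else 2) (compile_stmt s (\<eta>(x := d)) (d
    + 2))"

fun stmt_cost :: "stmt \<Rightarrow> nat poly" where
  "stmt_cost (StoreAt e1 e2) = expr_cost e1 + expr_cost e2 + 1"
| "stmt_cost (For x b s) = [:4:] + [:0, 1:] * (stmt_cost s + [:5:])"

text \<open>Results pass from round to round through memory alone; registers from \<open>d\<close>
  on are scratch. That is why \<open>run\<close> is a function on memories.\<close>

lemma runs_compile_stmt:
  assumes "\<And>x. \<eta> x < d" "3 \<le> d" "\<rho> 1 = n" "\<rho> 2 = m" "n \<le> K" "m \<le> K"
  shows "\<exists>\<rho>'. runs (compile_stmt s \<eta> d) (\<rho>, \<mu>) (poly (stmt_cost s) K) (\<rho>', run n m s (\<rho> \<circ> \<eta>) \<mu>)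
    \<and> (\<forall>r<d. \<rho>' r = \<rho> r)"
  using assms(1-4)
proof (induction s arbitrary: \<eta> d \<rho> \<mu>)
  case (StoreAt e1 e2)
  obtain \<rho>1 where 1: "runs (compile_expr e1 \<eta> d) (\<rho>, \<mu>) (poly (expr_cost e1) K) (\<rho>1, \<mu>)"
      "\<rho>1 d = eval n m \<mu> e1 (\<rho> \<circ> \<eta>)" "\<forall>r<d. \<rho>1 r = \<rho> r"
    using runs_compile_expr[of \<eta> d \<rho> n m K e1 \<mu>] StoreAt.prems assms(5,6) by blast
  have eq: "\<rho>1 \<circ> \<eta> = \<rho> \<circ> \<eta>"
    using 1(3) StoreAt.prems(1) by auto
  have \<rho>1: "\<rho>1 1 = n" "\<rho>1 2 = m" "\<And>x. \<eta> x < d + 1" "3 \<le> d + 1"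
    using 1(3) StoreAt.prems by (auto intro: less_SucI)
  obtain \<rho>2 where 2: "runs (compile_expr e2 \<eta> (d + 1)) (\<rho>1, \<mu>) (poly (expr_cost e2) K) (\<rho>2, \<mu>)"
      "\<rho>2 (d + 1) = eval n m \<mu> e2 (\<rho>1 \<circ> \<eta>)" "\<forall>r<d + 1. \<rho>2 r = \<rho>1 r"
    using runs_compile_expr[of \<eta> "d + 1" \<rho>1 n m K e2 \<mu>] \<rho>1 assms(5,6) by blast
  have "runs (compile_stmt (StoreAt e1 e2) \<eta> d) (\<rho>, \<mu>)
      (poly (expr_cost e1) K + (poly (expr_cost e2) K + 1)) (\<rho>2, \<mu>(\<rho>2 d := \<rho>2 (d + 1)))"
    unfolding compile_stmt.simps by (intro runs_Seq[OF 1(1)] runs_Seq[OF 2(1)] runs_Store)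
  moreover have "\<rho>2 d = eval n m \<mu> e1 (\<rho> \<circ> \<eta>)" "\<rho>2 (d + 1) = eval n m \<mu> e2 (\<rho> \<circ> \<eta>)"
    using 1(2) 2(2,3) eq by auto
  ultimately show ?case
    using 1(3) 2(3) by (intro exI[of _ \<rho>2] conjI) (simp_all only: run.simps stmt_cost.simps
        poly_add poly_1 add.assoc, auto)
next
  case (For x b s)
  define l where "l = (if b then n else m)"
  define J where "J i \<rho>' \<mu>' \<longleftrightarrow> (\<forall>r<d. \<rho>' r = \<rho> r)
    \<and> \<mu>' = fold (\<lambda>i. run n m s ((\<rho> \<circ> \<eta>)(x := i))) [0..<i] \<mu>" for i \<rho>' \<mu>'
  have "\<exists>\<rho>' \<mu>'. runs (compile_stmt (For x b s) \<eta> d) (\<rho>, \<mu>)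
      (4 + l * (poly (stmt_cost s) K + 5)) (\<rho>', \<mu>') \<and> J l \<rho>' \<mu>'"
    unfolding compile_stmt.simps
  proof (rule runs_count_loop)
    show "\<rho> (if b then 1 else 2) = l" "(if b then 1 else 2) < d"
      using For.prems(2-4) by (auto simp: l_def)
    show "J 0 \<rho> \<mu>"
      by (simp add: J_def)
    show "J i (\<rho>'(d := v, d + 1 := w, d + 2 := z)) \<mu>'" if "J i \<rho>' \<mu>'" for i \<rho>' \<mu>' v w z
      using that by (auto simp: J_def)
    fix i \<rho>1 \<mu>1
    assume i: "i < l" "J i \<rho>1 \<mu>1" "\<rho>1 d = i"
    have \<rho>1: "\<forall>r<d. \<rho>1 r = \<rho> r"
      using i(2) by (auto simp: J_def)
    then have eq: "\<rho>1 \<circ> \<eta>(x := d) = (\<rho> \<circ> \<eta>)(x := i)"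
      using For.prems(1) i(3) by auto
    have \<rho>1': "\<And>y. (\<eta>(x := d)) y < d + 2" "\<rho>1 1 = n" "\<rho>1 2 = m" "3 \<le> d + 2"
      using For.prems \<rho>1 by (auto intro: less_SucI)
    then obtain \<rho>2 where 2: "runs (compile_stmt s (\<eta>(x := d)) (d + 2)) (\<rho>1, \<mu>1) (poly (stmt_cost
        s) K)
          (\<rho>2, run n m s ((\<rho> \<circ> \<eta>)(x := i)) \<mu>1)" "\<forall>r<d + 2. \<rho>2 r = \<rho>1 r"
      using For.IH[of "\<eta>(x := d)" "d + 2" \<rho>1 \<mu>1] \<rho>1' unfolding eq by blast
    moreover have "J (Suc i) \<rho>2 (run n m s ((\<rho> \<circ> \<eta>)(x := i)) \<mu>1)"
      using i(2) 2(2) by (auto simp: J_def)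
    ultimately show "\<exists>\<rho>' \<mu>'. runs (compile_stmt s (\<eta>(x := d)) (d + 2)) (\<rho>1, \<mu>1)
        (poly (stmt_cost s) K) (\<rho>', \<mu>') \<and> \<rho>' d = i \<and> \<rho>' (d + 1) = \<rho>1 (d + 1) \<and> J (Suc i) \<rho>' \<mu>'"
      using i(3) by (intro exI[of _ \<rho>2] exI[of _ "run n m s ((\<rho> \<circ> \<eta>)(x := i)) \<mu>1"]) auto
  qed
  then obtain \<rho>' \<mu>' where *: "runs (compile_stmt (For x b s) \<eta> d) (\<rho>, \<mu>)
      (4 + l * (poly (stmt_cost s) K + 5)) (\<rho>', \<mu>')" "J l \<rho>' \<mu>'"
    by blast
  have "l * (poly (stmt_cost s) K + 5) \<le> K * (poly (stmt_cost s) K + 5)"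
    using assms(5,6) by (auto simp: l_def intro!: mult_le_mono)
  then have "4 + l * (poly (stmt_cost s) K + 5) \<le> poly (stmt_cost (For x b s)) K"
    by (auto simp: algebra_simps)
  with *(1) have "runs (compile_stmt (For x b s) \<eta> d) (\<rho>, \<mu>) (poly (stmt_cost (For x b s)) K) (\<rho>',
      \<mu>')"
    by (rule runs_mono)
  moreover have "\<mu>' = run n m (For x b s) (\<rho> \<circ> \<eta>) \<mu>" "\<forall>r<d. \<rho>' r = \<rho> r"
    using *(2) by (simp_all add: J_def l_def)
  ultimately show ?case
    by blast
qed


section \<open>The decision program\<close>

text \<open>Subtraction is truncated and any nonzero value is true, so \<open>1 - v\<close> is 1
  exactly if \<open>v\<close> is false.\<close>

definition Neg :: "expr \<Rightarrow> expr" where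
  "Neg e = Minus (Num 1) e"

definition Conj :: "expr \<Rightarrow> expr \<Rightarrow> expr" where
  "Conj e1 e2 = Ite e1 e2 (Num 0)"

definition Disj :: "expr \<Rightarrow> expr \<Rightarrow> expr" where
  "Disj e1 e2 = Ite e1 (Num 1) e2"

definition Neq :: "expr \<Rightarrow> expr \<Rightarrow> expr" where
  "Neq e1 e2 = Plus (Minus e1 e2) (Minus e2 e1)"

text \<open>Products are sums over a loop variable (9) that does not occur in the summand.\<close>

definition times_n :: "expr \<Rightarrow> expr" where
  "times_n e = SumLt 9 True e"

definition times_m :: "expr \<Rightarrow> expr" where
  "times_m e = SumLt 9 False e"

text \<open>The arguments are names of variables. Matrices start at address 2, behind
  \<open>n\<close> and \<open>m\<close>, in row-major order; variables count from 0 where agents and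
  objects count from 1.\<close>

definition prefers :: "nat \<Rightarrow> nat \<Rightarrow> nat \<Rightarrow> expr" where
  "prefers i a b = Mem (Plus (Num 2) (Plus (times_m (times_m (Var i))) (Plus (times_m (Var a))
      (Var b))))"

text \<open>The characteristic vectors lie behind the \<open>n\<close> matrices of
  \<open>m * m\<close> entries each.\<close>

definition owns :: "nat \<Rightarrow> nat \<Rightarrow> expr" where
  "owns i a = Mem (Plus (Num 2) (Plus (times_n (times_m (times_m (Num 1)))) (Plus (times_m (Var
      i)) (Var a))))"

text \<open>The table of the transitive closure is stored directly behind the input.\<close>

definition reach_addr :: "nat \<Rightarrow> nat \<Rightarrow> expr" where
  "reach_addr a b = Plus (Num 2) (Plus (times_n (times_m (times_m (Num 1))))
    (Plus (times_n (times_m (Num 1))) (Plus (times_m (Var a)) (Var b))))"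

text \<open>Variable 8 ranges over agents and 9 is taken by products. Object variables therefore
  stay below 8, which avoids capture.\<close>

definition acceptable :: "nat \<Rightarrow> nat \<Rightarrow> expr" where
  "acceptable a b = SumLt 8 True (Conj (owns 8 b) (prefers 8 a b))"

definition improving :: "nat \<Rightarrow> nat \<Rightarrow> expr" where
  "improving a b = SumLt 8 True (Conj (owns 8 b) (Conj (prefers 8 a b) (Neg (prefers 8 b a))))"

text \<open>One entry of the table is extended by a single edge at the end of a path. The update is
  in place, so entries written earlier in the same round are already taken into account.\<close>

definition extend_reach :: stmt where
  "extend_reach = StoreAt (reach_addr 0 1)
    (Disj (Mem (reach_addr 0 1)) (Disj (acceptable 0 1)
      (SumLt 2 False (Conj (Mem (reach_addr 0 2)) (acceptable 2 1)))))"

text \<open>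
  \<open>m * m\<close> rounds suffice because the transitive closure of a relation is the union of its first
  \<open>card\<close> many powers.
\<close>

definition compute_reach :: stmt where
  "compute_reach = For 3 False (For 4 False (For 0 False (For 1 False extend_reach)))"

definition cycle_test :: expr where
  "cycle_test = SumLt 0 False (SumLt 1 False (Conj (improving 0 1) (Mem (reach_addr 1 0))))"

definition swap_test :: expr where
  "swap_test = SumLt 8 True (SumLt 0 False (SumLt 1 False (SumLt 2 False
    (Conj (Neg (owns 8 0)) (Conj (owns 8 1) (Conj (owns 8 2) (Conj (Neq (Var 1) (Var 2))
      (Conj (Neg (prefers 8 1 0)) (Neg (prefers 8 2 0))))))))))"

text \<open>The outer \<open>Neg\<close> also normalises the truth value to 0 or 1, as required of
  register 0.\<close>

definition answer :: expr where
  "answer = Neg (Disj cycle_test swap_test)"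

context
  fixes n m :: nat and \<mu> \<sigma> :: "nat \<Rightarrow> nat"
begin

lemma eval_Neg [simp]: "eval n m \<mu> (Neg e) \<sigma> = of_bool (eval n m \<mu> e \<sigma> = 0)"
  by (simp add: Neg_def)

lemma eval_Conj [simp]: "eval n m \<mu> (Conj e1 e2) \<sigma> \<noteq> 0 \<longleftrightarrow> eval n m \<mu> e1 \<sigma> \<noteq> 0 \<and> eval n m \<mu> e2 \<sigma> \<noteq> 0"
  by (simp add: Conj_def)

lemma eval_Disj [simp]: "eval n m \<mu> (Disj e1 e2) \<sigma> \<noteq> 0 \<longleftrightarrow> eval n m \<mu> e1 \<sigma> \<noteq> 0 \<or> eval n m \<mu> e2 \<sigma> \<noteq> 0"
  by (simp add: Disj_def)

lemma eval_Neq [simp]: "eval n m \<mu> (Neq e1 e2) \<sigma> \<noteq> 0 \<longleftrightarrow> eval n m \<mu> e1 \<sigma> \<noteq> eval n m \<mu> e2 \<sigma>"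
  by (auto simp: Neq_def)

lemma eval_SumLt_nonzero: "eval n m \<mu> (SumLt x b e) \<sigma> \<noteq> 0 \<longleftrightarrow>
    (\<exists>i<(if b then n else m). eval n m \<mu> e (\<sigma>(x := i)) \<noteq> 0)"
  by (auto simp: lessThan_def)

lemma eval_prefers:
  assumes "i \<noteq> 9" "a \<noteq> 9" "b \<noteq> 9"
  shows "eval n m \<mu> (prefers i a b) \<sigma> = \<mu> (2 + (m * (m * \<sigma> i) + (m * \<sigma> a + \<sigma> b)))"
  using assms by (simp add: prefers_def times_m_def del: add_2_eq_Suc)

lemma eval_owns:
  assumes "i \<noteq> 9" "a \<noteq> 9"
  shows "eval n m \<mu> (owns i a) \<sigma> = \<mu> (2 + (n * (m * m) + (m * \<sigma> i + \<sigma> a)))"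
  using assms by (simp add: owns_def times_m_def times_n_def del: add_2_eq_Suc)

lemma eval_reach_addr:
  assumes "a \<noteq> 9" "b \<noteq> 9"
  shows "eval n m \<mu> (reach_addr a b) \<sigma> = 2 + (n * (m * m) + (n * m + (m * \<sigma> a + \<sigma> b)))"
  using assms by (simp add: reach_addr_def times_m_def times_n_def del: add_2_eq_Suc)

end

section \<open>Memory layout and input encoding\<close>

definition represents :: "inst \<Rightarrow> (nat \<Rightarrow> nat) \<Rightarrow> bool" where
  "represents x \<mu> \<longleftrightarrow> (case x of (n, m, R, p) \<Rightarrow>
    (\<forall>i<n. \<forall>a<m. \<forall>b<m. \<mu> (2 + (m * (m * i) + (m * a + b))) \<noteq> 0 \<longleftrightarrow> (Suc a, Suc b) \<in> R (Suc i)) \<and>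
    (\<forall>i<n. \<forall>a<m. \<mu> (2 + (n * (m * m) + (m * i + a))) \<noteq> 0 \<longleftrightarrow> Suc a \<in> p (Suc i)))"

lemma mult_add_less:
  fixes a b m k :: nat
  assumes "a < k" "b < m"
  shows "m * a + b < m * k"
proof -
  have "m * a + b < m * Suc a"
    using assms(2) by simp
  also have "\<dots> \<le> m * k"
    using assms(1) by (intro mult_le_mono) auto
  finally show ?thesis .
qed

text \<open>Quotient and remainder by \<open>m\<close> are unique; hence different table entries
  have different addresses.\<close>

lemma mult_add_eq_iff:
  fixes a b a' b' m :: nat
  assumes "b < m" "b' < m"
  shows "m * a + b = m * a' + b' \<longleftrightarrow> a = a' \<and> b = b'"
proof
  assume eq: "m * a + b = m * a' + b'"
  have "(m * a + b) div m = (m * a' + b') div m" "(m * a + b) mod m = (m * a' + b') mod m"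
    using eq by simp_all
  then show "a = a' \<and> b = b'"
    using assms by simp
qed simp

lemma fold_upt_invariant:
  assumes "P 0 s" "\<And>i s. i < n \<Longrightarrow> P i s \<Longrightarrow> P (Suc i) (f i s)"
  shows "P n (fold f [0..<n] s)"
  using assms by (induction n) auto

text \<open>Position \<open>j\<close> of block \<open>i\<close> in a row-major list. Applied to the
  list of matrices and again to the rows of one matrix, it decodes the nested comprehension of
  \<open>encode\<close>.\<close>

lemma nth_concat_uniform:
  assumes "\<And>ys. ys \<in> set xss \<Longrightarrow> length ys = l" "i < length xss" "j < l"
  shows "concat xss ! (l * i + j) = xss ! i ! j"
  using assms
proof (induction xss arbitrary: i)
  case (Cons xs xss)
  then show ?case
    by (cases i) (auto simp: nth_append)
qed simp

lemma length_concat_uniform: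
  assumes "\<And>ys. ys \<in> set xss \<Longrightarrow> length ys = l"
  shows "length (concat xss) = length xss * l"
  using assms by (induction xss) auto

lemma length_encode: "length (encode (n, m, R, p)) = 2 + (n * (m * m) + n * m)"
proof -
  have *: "length (concat (map (\<lambda>a. map (\<lambda>b. of_bool ((a, b) \<in> R i) :: nat) [1..<Suc m]) [1..<Suc
      m])) = m * m" for i
    by (subst length_concat_uniform[where l = m]) auto
  have "length (concat (map (\<lambda>i. concat (map (\<lambda>a. map (\<lambda>b. of_bool ((a, b) \<in> R i) :: nat) [1..<Suc
      m]) [1..<Suc m])) [1..<Suc n]))
      = n * (m * m)"
    by (subst length_concat_uniform[where l = "m * m"]) (use * in auto)
  moreover have "length (concat (map (\<lambda>i. map (\<lambda>a. of_bool (a \<in> p i) :: nat) [1..<Suc m]) [1..<Suc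
      n])) = n * m"
    by (subst length_concat_uniform[where l = m]) auto
  ultimately show ?thesis
    by simp
qed

lemma represents_encode:
  shows "represents (n, m, R, p) (snd (init_state (encode (n, m, R, p))))"
proof -
  define ms where "ms = [1..<Suc m]"
  \<comment> \<open>The lists start at 1 and positions at 0: this is the origin of every
    \<open>Suc\<close> in \<open>represents\<close>.\<close>
  have ms: "length ms = m" "\<And>a. a < m \<Longrightarrow> ms ! a = Suc a"
    by (auto simp: ms_def simp del: upt_Suc)
  define ns where "ns = [1..<Suc n]"
  have ns: "length ns = n" "\<And>i. i < n \<Longrightarrow> ns ! i = Suc i"
    by (auto simp: ns_def simp del: upt_Suc)
  define row where "row i a = map (\<lambda>b. of_bool ((a, b) \<in> R i) :: nat) ms" for i a
  define mat where "mat i = concat (map (row i) ms)" for i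
  define mats where "mats = concat (map mat ns)"
  define bvec where "bvec i = map (\<lambda>a. of_bool (a \<in> p i) :: nat) ms" for i
  define bundles where "bundles = concat (map bvec ns)"
  have enc: "encode (n, m, R, p) = [n, m] @ mats @ bundles"
    by (simp only: encode.simps mats_def bundles_def mat_def[abs_def] row_def[abs_def]
        bvec_def[abs_def] ms_def ns_def)
  have len_row: "length (row i a) = m" for i a
    by (simp add: row_def ms)
  have len_mat: "length (mat i) = m * m" for i
    unfolding mat_def by (subst length_concat_uniform[where l = m]) (auto simp: len_row ms)
  have len_mats: "length mats = n * (m * m)"
    unfolding mats_def by (subst length_concat_uniform[where l = "m * m"]) (auto simp: len_mat ns)
  have len_bundle: "length (bvec i) = m" for i
    by (simp add: bvec_def ms)
  have len_bundles: "length bundles = n * m"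
    unfolding bundles_def by (subst length_concat_uniform[where l = m]) (auto simp: len_bundle ns)
  have mats_nth: "mats ! (m * (m * i) + (m * a + b)) = of_bool ((Suc a, Suc b) \<in> R (Suc i))"
    and mats_less: "m * (m * i) + (m * a + b) < n * (m * m)"
    if "i < n" "a < m" "b < m" for i a b
  proof -
    have ab: "m * a + b < m * m"
      using that(2,3) by (rule mult_add_less)
    have "mats ! ((m * m) * i + (m * a + b)) = map mat ns ! i ! (m * a + b)"
      unfolding mats_def using that ab by (intro nth_concat_uniform) (auto simp: len_mat ns)
    also have "\<dots> = mat (Suc i) ! (m * a + b)"
      using that by (simp add: ns)
    also have "\<dots> = map (row (Suc i)) ms ! a ! b"
      unfolding mat_def using that by (intro nth_concat_uniform) (auto simp: len_row ms)
    also have "\<dots> = of_bool ((Suc a, Suc b) \<in> R (Suc i))"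
      using that by (simp add: row_def ms)
    finally show "mats ! (m * (m * i) + (m * a + b)) = of_bool ((Suc a, Suc b) \<in> R (Suc i))"
      by (simp add: mult.assoc)
    show "m * (m * i) + (m * a + b) < n * (m * m)"
      using mult_add_less[OF that(1) ab] by (simp add: ac_simps)
  qed
  have bundles_nth: "bundles ! (m * i + a) = of_bool (Suc a \<in> p (Suc i))"
    and bundles_less: "m * i + a < n * m" if "i < n" "a < m" for i a
  proof -
    have "bundles ! (m * i + a) = map bvec ns ! i ! a"
      unfolding bundles_def using that by (intro nth_concat_uniform) (auto simp: len_bundle ns)
    also have "\<dots> = of_bool (Suc a \<in> p (Suc i))"
      using that by (simp add: ns ms bvec_def)
    finally show "bundles ! (m * i + a) = of_bool (Suc a \<in> p (Suc i))" .
    show "m * i + a < n * m"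
      using mult_add_less[OF that] by (simp add: ac_simps)
  qed
  have mem: "snd (init_state (encode (n, m, R, p))) (2 + k) =
      (if k < n * (m * m) then mats ! k else bundles ! (k - n * (m * m)))" if "k < n * (m * m) + n
          * m" for k
    using that unfolding init_state_def enc by (simp add: len_mats len_bundles nth_append)
  show ?thesis
    unfolding represents_def prod.case
  proof (intro conjI allI impI)
    fix i a b
    assume "i < n" "a < m" "b < m"
    then show "snd (init_state (encode (n, m, R, p))) (2 + (m * (m * i) + (m * a + b))) \<noteq> 0
        \<longleftrightarrow> (Suc a, Suc b) \<in> R (Suc i)"
      using mem[of "m * (m * i) + (m * a + b)"] mats_nth mats_less[of i a b] by simp
  next
    fix i a
    assume "i < n" "a < m"
    then show "snd (init_state (encode (n, m, R, p))) (2 + (n * (m * m) + (m * i + a))) \<noteq> 0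
        \<longleftrightarrow> Suc a \<in> p (Suc i)"
      using mem[of "n * (m * m) + (m * i + a)"] bundles_nth bundles_less[of i a] by simp
  qed
qed

definition reach :: "nat \<Rightarrow> nat \<Rightarrow> (nat \<Rightarrow> nat) \<Rightarrow> nat rel" where
  "reach n m \<mu> = {(Suc a, Suc b) | a b. a < m \<and> b < m
    \<and> \<mu> (2 + (n * (m * m) + (n * m + (m * a + b)))) \<noteq> 0}"

section \<open>Correctness of the decision program\<close>

locale decision_instance =
  fixes n m :: nat and R :: "nat \<Rightarrow> nat rel" and p :: "nat \<Rightarrow> nat set"
  assumes inst_mem: "(n, m, R, p) \<in> instances"
begin

abbreviation E :: "nat rel" where
  "E \<equiv> acceptable_moves {1..n} {1..m} R p"

abbreviation Imp :: "nat rel" where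
  "Imp \<equiv> improving_moves {1..n} {1..m} R p"

lemma profile: "is_preference_profile {1..n} {1..m} R"
  and assignment: "is_assignment {1..n} {1..m} p"
  using inst_mem by (auto simp: instances_def)

lemma p_subset: "i \<in> {1..n} \<Longrightarrow> p i \<subseteq> {1..m}"
  using assignment by (auto simp: is_assignment_def)

lemma E_subset: "E \<subseteq> {1..m} \<times> {1..m}"
  using p_subset by (fastforce simp: acceptable_moves_def)

lemma ex_agent: "(\<exists>i\<in>{1..n}. P i) \<longleftrightarrow> (\<exists>i<n. P (Suc i))"
  unfolding image_Suc_lessThan[symmetric] bex_simps by (simp add: Bex_def)

lemma ex_object: "(\<exists>a\<in>{1..m}. P a) \<longleftrightarrow> (\<exists>a<m. P (Suc a))"
  unfolding image_Suc_lessThan[symmetric] bex_simps by (simp add: Bex_def)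

text \<open>An equation with 0 rewrites formulas under \<open>Neg\<close> and, negated, true
  formulas alike. For this to match, \<open>neq0_conv\<close> is switched off where such rules are
  applied.\<close>

lemma prefers_iff:
  assumes "represents (n, m, R, p) \<mu>" "i \<noteq> 9" "a \<noteq> 9" "b \<noteq> 9" "\<sigma> i < n" "\<sigma> a < m" "\<sigma> b < m"
  shows "eval n m \<mu> (prefers i a b) \<sigma> = 0 \<longleftrightarrow> (Suc (\<sigma> a), Suc (\<sigma> b)) \<notin> R (Suc (\<sigma> i))"
  using assms(1,5-) unfolding eval_prefers[OF assms(2-4)] represents_def prod.case by blast

lemma owns_iff:
  assumes "represents (n, m, R, p) \<mu>" "i \<noteq> 9" "a \<noteq> 9" "\<sigma> i < n" "\<sigma> a < m"
  shows "eval n m \<mu> (owns i a) \<sigma> = 0 \<longleftrightarrow> Suc (\<sigma> a) \<notin> p (Suc (\<sigma> i))"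
  using assms(1,4-) unfolding eval_owns[OF assms(2,3)] represents_def prod.case by blast

lemma reach_iff:
  assumes "a \<noteq> 9" "b \<noteq> 9" "\<sigma> a < m" "\<sigma> b < m"
  shows "eval n m \<mu> (Mem (reach_addr a b)) \<sigma> = 0 \<longleftrightarrow> (Suc (\<sigma> a), Suc (\<sigma> b)) \<notin> reach n m \<mu>"
  using assms by (auto simp: eval_reach_addr reach_def simp del: add_2_eq_Suc)

lemma acceptable_iff:
  assumes "represents (n, m, R, p) \<mu>" "a < 8" "b < 8" "\<sigma> a < m" "\<sigma> b < m"
  shows "eval n m \<mu> (acceptable a b) \<sigma> = 0 \<longleftrightarrow> (Suc (\<sigma> a), Suc (\<sigma> b)) \<notin> E"
proof -
  have "a \<noteq> 8" "b \<noteq> 8" "a \<noteq> 9" "b \<noteq> 9"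
    using assms(2,3) by simp_all
  then have "eval n m \<mu> (acceptable a b) \<sigma> \<noteq> 0 \<longleftrightarrow> (Suc (\<sigma> a), Suc (\<sigma> b)) \<in> E"
    unfolding acceptable_def eval_SumLt_nonzero eval_Conj acceptable_moves_def mem_Collect_eq
        prod.case ex_agent
    using assms by (simp add: owns_iff[OF assms(1)] prefers_iff[OF assms(1)] cong: conj_cong del:
        neq0_conv)
  then show ?thesis
    by blast
qed

lemma improving_iff:
  assumes "represents (n, m, R, p) \<mu>" "a < 8" "b < 8" "\<sigma> a < m" "\<sigma> b < m"
  shows "eval n m \<mu> (improving a b) \<sigma> = 0 \<longleftrightarrow> (Suc (\<sigma> a), Suc (\<sigma> b)) \<notin> Imp"
proof -
  have "a \<noteq> 8" "b \<noteq> 8" "a \<noteq> 9" "b \<noteq> 9"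
    using assms(2,3) by simp_all
  then have "eval n m \<mu> (improving a b) \<sigma> \<noteq> 0 \<longleftrightarrow> (Suc (\<sigma> a), Suc (\<sigma> b)) \<in> Imp"
    unfolding improving_def eval_SumLt_nonzero eval_Conj eval_Neg improving_moves_def
        mem_Collect_eq prod.case ex_agent
    using assms by (simp add: owns_iff[OF assms(1)] prefers_iff[OF assms(1)] cong: conj_cong del:
        neq0_conv)
  then show ?thesis
    by blast
qed

text \<open>The written cell lies behind the input, so the instance stays represented; by
  injectivity of the addresses only the entry \<open>ab\<close> can change.\<close>

lemma run_extend_reach:
  assumes rep: "represents (n, m, R, p) \<mu>" and ab: "\<sigma> 0 < m" "\<sigma> 1 < m"
  defines "\<mu>' \<equiv> run n m extend_reach \<sigma> \<mu>" and "ab \<equiv> (Suc (\<sigma> 0), Suc (\<sigma> 1))"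
  shows "represents (n, m, R, p) \<mu>'"
    and "reach n m \<mu>' = reach n m \<mu> \<union> ({ab} \<inter> (E \<union> reach n m \<mu> O E))"
proof -
  define v where "v = eval n m \<mu> (Disj (Mem (reach_addr 0 1)) (Disj (acceptable 0 1)
      (SumLt 2 False (Conj (Mem (reach_addr 0 2)) (acceptable 2 1))))) \<sigma>"
  define k where "k = m * \<sigma> 0 + \<sigma> 1"
  have \<mu>': "\<mu>' = \<mu>(2 + (n * (m * m) + (n * m + k)) := v)"
    by (simp add: \<mu>'_def extend_reach_def v_def k_def eval_reach_addr del: add_2_eq_Suc eval.simps)
  have "m * (m * i) + (m * a + b) < n * (m * m)" if "i < n" "a < m" "b < m" for i a b
    using mult_add_less[OF that(1) mult_add_less[OF that(2,3)]] by (simp add: ac_simps)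
  moreover have "m * i + a < n * m" if "i < n" "a < m" for i a
    using mult_add_less[OF that] by (simp add: ac_simps)
  ultimately show "represents (n, m, R, p) \<mu>'"
    using rep unfolding represents_def \<mu>' prod.case
    by (auto simp del: add_2_eq_Suc neq0_conv) (fastforce simp del: add_2_eq_Suc neq0_conv)+
  have "v \<noteq> 0 \<longleftrightarrow> ab \<in> reach n m \<mu> \<or> ab \<in> E \<or> (\<exists>c<m. (Suc (\<sigma> 0), Suc c) \<in> reach n m \<mu> \<and> (Suc c, Suc
      (\<sigma> 1)) \<in> E)"
    unfolding v_def ab_def eval_Disj eval_SumLt_nonzero eval_Conj
    using ab by (simp add: reach_iff acceptable_iff[OF rep] cong: conj_cong del: eval.simps
        neq0_conv)
  also have "(\<exists>c<m. (Suc (\<sigma> 0), Suc c) \<in> reach n m \<mu> \<and> (Suc c, Suc (\<sigma> 1)) \<in> E) \<longleftrightarrow> ab \<in> reach n m \<mu>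
      O E"
    unfolding ab_def by (auto simp: reach_def)
  finally have v: "v \<noteq> 0 \<longleftrightarrow> ab \<in> reach n m \<mu> \<or> ab \<in> E \<union> reach n m \<mu> O E"
    by blast
  have "(x, y) \<in> reach n m \<mu>' \<longleftrightarrow> (x, y) \<in> reach n m \<mu> \<union> ({ab} \<inter> (E \<union> reach n m \<mu> O E))" for x y
  proof (cases "(x, y) = ab")
    case True
    have "(x, y) \<in> reach n m \<mu>' \<longleftrightarrow> v \<noteq> 0"
      using True ab by (auto simp: reach_def \<mu>' ab_def k_def simp del: neq0_conv)
    then show ?thesis
      using v True by blast
  next
    case False
    have "m * a + b \<noteq> k" if "(Suc a, Suc b) = (x, y)" "b < m" for a b
      using that False ab mult_add_eq_iff[of b m "\<sigma> 1" a "\<sigma> 0"] by (auto simp: k_def ab_def)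
    then have "(x, y) \<in> reach n m \<mu>' \<longleftrightarrow> (x, y) \<in> reach n m \<mu>"
      unfolding reach_def \<mu>' by (auto simp del: neq0_conv)
    then show ?thesis
      using False by blast
  qed
  then show "reach n m \<mu>' = reach n m \<mu> \<union> ({ab} \<inter> (E \<union> reach n m \<mu> O E))"
    by auto
qed

text \<open>Because of the updates in place, the exact contents after a round depend on the order of
  visits. Two inclusions suffice: the table never leaves the closure, and it absorbs at least one
  further edge.\<close>

lemma run_reach_round:
  fixes \<mu>0 \<sigma> :: "nat \<Rightarrow> nat"
  assumes rep: "represents (n, m, R, p) \<mu>0" and sound: "reach n m \<mu>0 \<subseteq> E\<^sup>+"
  defines "\<mu>' \<equiv> run n m (For 0 False (For 1 False extend_reach)) \<sigma> \<mu>0"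
  shows "represents (n, m, R, p) \<mu>'" "reach n m \<mu>' \<subseteq> E\<^sup>+"
    "reach n m \<mu>0 \<union> E \<union> reach n m \<mu>0 O E \<subseteq> reach n m \<mu>'"
proof -
  \<comment> \<open>\<open>D\<close> contains the entries visited so far. Completeness refers to the
    table at the start of the round, so it persists while the table grows.\<close>
  define Inv where "Inv D \<mu> \<longleftrightarrow> represents (n, m, R, p) \<mu> \<and> reach n m \<mu>0 \<subseteq> reach n m \<mu>
    \<and> reach n m \<mu> \<subseteq> E\<^sup>+ \<and> D \<inter> (E \<union> reach n m \<mu>0 O E) \<subseteq> reach n m \<mu>" for D \<mu>
  have step: "Inv (insert (Suc (\<sigma>' 0), Suc (\<sigma>' 1)) D) (run n m extend_reach \<sigma>' \<mu>)"
    if "Inv D \<mu>" "\<sigma>' 0 < m" "\<sigma>' 1 < m" for D \<mu> and \<sigma>' :: "nat \<Rightarrow> nat"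
  proof -
    define X where "X = E \<union> reach n m \<mu>0 O E"
    define Y where "Y = E \<union> reach n m \<mu> O E"
    define ab where "ab = (Suc (\<sigma>' 0), Suc (\<sigma>' 1))"
    have inv: "represents (n, m, R, p) \<mu>" "reach n m \<mu>0 \<subseteq> reach n m \<mu>" "reach n m \<mu> \<subseteq> E\<^sup>+"
      "D \<inter> X \<subseteq> reach n m \<mu>"
      using that(1) unfolding Inv_def X_def by blast+
    have "X \<subseteq> Y"
      unfolding X_def Y_def using inv(2) by (intro Un_mono relcomp_mono) simp_all
    have "E\<^sup>+ O E \<subseteq> E\<^sup>+"
      by (auto intro: trancl_into_trancl)
    then have "Y \<subseteq> E\<^sup>+"
      unfolding Y_def using inv(3) relcomp_mono[OF inv(3) order_refl, of E] by (intro Un_least) auto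
    have eq: "reach n m (run n m extend_reach \<sigma>' \<mu>) = reach n m \<mu> \<union> ({ab} \<inter> Y)"
      unfolding ab_def Y_def using inv(1) that(2,3) by (rule run_extend_reach(2))
    show ?thesis
      unfolding Inv_def X_def[symmetric] ab_def[symmetric] eq
    proof (intro conjI)
      show "represents (n, m, R, p) (run n m extend_reach \<sigma>' \<mu>)"
        using inv(1) that(2,3) by (rule run_extend_reach(1))
    qed (use inv \<open>X \<subseteq> Y\<close> \<open>Y \<subseteq> E\<^sup>+\<close> in blast)+
  qed
  \<comment> \<open>The entries visited in lexicographic order when the outer loop is at
    \<open>a\<close> and the inner one at \<open>b\<close>; a finished row equals the start of the
    next one.\<close>
  define D where "D a b = {(x, y). x \<in> {1..m} \<and> y \<in> {1..m} \<and> (x \<le> a \<or> x = Suc a \<and> y \<le> b)}" for a b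
  have D_Suc: "D a (Suc b) = insert (Suc a, Suc b) (D a b)" if "a < m" "b < m" for a b
    using that by (auto simp: D_def)
  have D_m: "D a m = D (Suc a) 0" for a
    by (auto simp: D_def)
  have inner: "Inv (D (Suc a) 0) (run n m (For 1 False extend_reach) (\<sigma>(0 := a)) \<mu>)"
    if "a < m" "Inv (D a 0) \<mu>" for a \<mu>
  proof -
    have "Inv (D a m) (fold (\<lambda>b. run n m extend_reach (\<sigma>(0 := a, 1 := b))) [0..<m] \<mu>)"
    proof (rule fold_upt_invariant[where P = "\<lambda>b. Inv (D a b)"])
      show "Inv (D a (Suc b)) (run n m extend_reach (\<sigma>(0 := a, 1 := b)) \<mu>)"
        if b: "b < m" "Inv (D a b) \<mu>" for b \<mu>
        using step[OF b(2), of "\<sigma>(0 := a, 1 := b)"] D_Suc[OF \<open>a < m\<close> b(1)] b(1) \<open>a < m\<close> by simp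
    qed (use that in simp)
    then show ?thesis
      by (simp add: D_m)
  qed
  have "Inv (D m 0) (fold (\<lambda>a. run n m (For 1 False extend_reach) (\<sigma>(0 := a))) [0..<m] \<mu>0)"
  proof (rule fold_upt_invariant[where P = "\<lambda>a. Inv (D a 0)"])
    have "D 0 0 = {}"
      by (auto simp: D_def)
    then show "Inv (D 0 0) \<mu>0"
      using rep sound by (simp add: Inv_def)
  qed (rule inner)
  then have "Inv (D m 0) \<mu>'"
    unfolding \<mu>'_def by simp
  moreover have "E \<union> reach n m \<mu>0 O E \<subseteq> D m 0"
  proof -
    have "D m 0 = {1..m} \<times> {1..m}"
      by (auto simp: D_def)
    moreover have "reach n m \<mu>0 \<subseteq> {1..m} \<times> {1..m}"
      by (auto simp: reach_def)
    ultimately show ?thesis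
      using E_subset by blast
  qed
  ultimately have "E \<union> reach n m \<mu>0 O E \<subseteq> reach n m \<mu>'"
    unfolding Inv_def by (simp only: Int_absorb1)
  then show "reach n m \<mu>0 \<union> E \<union> reach n m \<mu>0 O E \<subseteq> reach n m \<mu>'"
    using \<open>Inv (D m 0) \<mu>'\<close> unfolding Inv_def by simp
  show "represents (n, m, R, p) \<mu>'" "reach n m \<mu>' \<subseteq> E\<^sup>+"
    using \<open>Inv (D m 0) \<mu>'\<close> unfolding Inv_def by simp_all
qed

lemma run_compute_reach:
  fixes \<mu>0 \<sigma> :: "nat \<Rightarrow> nat"
  assumes rep: "represents (n, m, R, p) \<mu>0" and init: "reach n m \<mu>0 = {}"
  defines "\<mu>' \<equiv> run n m compute_reach \<sigma> \<mu>0"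
  shows "represents (n, m, R, p) \<mu>'" and "reach n m \<mu>' = E\<^sup>+"
proof -
  \<comment> \<open>After \<open>k\<close> rounds all paths of length 1 to \<open>k\<close> are
    recorded; longer ones may be present as well and are controlled by the inclusion in the
    closure.\<close>
  define Inv where "Inv k \<mu> \<longleftrightarrow> represents (n, m, R, p) \<mu> \<and> reach n m \<mu> \<subseteq> E\<^sup>+
    \<and> (\<forall>l. 0 < l \<and> l \<le> k \<longrightarrow> E ^^ l \<subseteq> reach n m \<mu>)" for k \<mu>
  have round: "Inv (Suc k) (run n m (For 0 False (For 1 False extend_reach)) \<sigma>' \<mu>)"
    if inv: "Inv k \<mu>" for k \<mu> \<sigma>'
  proof -
    define \<mu>1 where "\<mu>1 = run n m (For 0 False (For 1 False extend_reach)) \<sigma>' \<mu>"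
    have 1: "represents (n, m, R, p) \<mu>1" "reach n m \<mu>1 \<subseteq> E\<^sup>+"
      "reach n m \<mu> \<union> E \<union> reach n m \<mu> O E \<subseteq> reach n m \<mu>1"
      using run_reach_round[of \<mu> \<sigma>'] inv unfolding Inv_def \<mu>1_def by blast+
    have "E ^^ l \<subseteq> reach n m \<mu>1" if l: "0 < l" "l \<le> Suc k" for l
    proof -
      obtain l' where l': "l = Suc l'"
        using l(1) by (cases l) auto
      show ?thesis
      proof (cases "l' = 0")
        case True
        then show ?thesis
          using l' 1(3) by simp
      next
        case False
        then have "E ^^ l' \<subseteq> reach n m \<mu>"
          using inv l l' unfolding Inv_def by simp
        then have "E ^^ l' O E \<subseteq> reach n m \<mu> O E"
          by (intro relcomp_mono) auto
        then show ?thesis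
          using 1(3) unfolding l' relpow.simps by blast
      qed
    qed
    then show ?thesis
      using 1 unfolding Inv_def \<mu>1_def by blast
  qed
  have inner: "Inv (m * Suc i) (run n m (For 4 False (For 0 False (For 1 False extend_reach))) \<sigma>'
      \<mu>)"
    if "Inv (m * i) \<mu>" for i \<mu> \<sigma>'
  proof -
    have "Inv (m * i + m) (fold (\<lambda>j. run n m (For 0 False (For 1 False extend_reach)) (\<sigma>'(4 :=
        j))) [0..<m] \<mu>)"
      by (rule fold_upt_invariant[where P = "\<lambda>j. Inv (m * i + j)"]) (use that round in simp_all)
    then show ?thesis
      by (simp add: add.commute)
  qed
  have "Inv (m * m) (fold (\<lambda>i. run n m (For 4 False (For 0 False (For 1 False extend_reach))) (\<sigma>(3
      := i))) [0..<m] \<mu>0)"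
  proof (rule fold_upt_invariant[where P = "\<lambda>i. Inv (m * i)"])
    show "Inv (m * 0) \<mu>0"
      using rep init by (simp add: Inv_def)
  qed (rule inner)
  then have inv: "Inv (m * m) \<mu>'"
    unfolding \<mu>'_def compute_reach_def by simp
  then show "represents (n, m, R, p) \<mu>'"
    by (simp add: Inv_def)
  have fin: "finite E"
    using E_subset finite_subset by blast
  have "card E \<le> m * m"
    using card_mono[OF _ E_subset] by simp
  then have "l \<le> m * m" if "l \<le> card E" for l
    using that by (rule order_trans[rotated])
  then have "E\<^sup>+ \<subseteq> reach n m \<mu>'"
    using inv unfolding trancl_finite_eq_relpow[OF fin] Inv_def by (intro UN_least) blast
  then show "reach n m \<mu>' = E\<^sup>+"
    using inv unfolding Inv_def by blast
qed

lemma eval_answer: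
  assumes rep: "represents (n, m, R, p) \<mu>" and closed: "reach n m \<mu> = E\<^sup>+"
  shows "eval n m \<mu> answer \<sigma> = of_bool (necessarily_pareto_optimal {1..n} {1..m} R p)"
proof -
  have "eval n m \<mu> cycle_test \<sigma> \<noteq> 0 \<longleftrightarrow>
      (\<exists>a<m. \<exists>b<m. (Suc a, Suc b) \<in> Imp \<and> (Suc b, Suc a) \<in> E\<^sup>+)"
    unfolding cycle_test_def eval_SumLt_nonzero eval_Conj
    by (simp add: reach_iff improving_iff[OF rep] closed cong: conj_cong del: eval.simps neq0_conv)
  also have "\<dots> \<longleftrightarrow> (\<exists>x\<in>{1..m}. \<exists>y\<in>{1..m}. (x, y) \<in> Imp \<and> (y, x) \<in> E\<^sup>+)"
    unfolding ex_object ..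
  \<comment> \<open>Bounding the quantifiers loses nothing, since both ends of a move are objects:
    the first by definition, the second as a member of a bundle.\<close>
  also have "\<dots> \<longleftrightarrow> has_improving_cycle {1..n} {1..m} R p"
    unfolding has_improving_cycle_def improving_moves_def using p_subset by blast
  finally have cycle: "eval n m \<mu> cycle_test \<sigma> \<noteq> 0 \<longleftrightarrow> has_improving_cycle {1..n} {1..m} R p" .
  have "eval n m \<mu> swap_test \<sigma> \<noteq> 0 \<longleftrightarrow>
      (\<exists>i<n. \<exists>x<m. \<exists>y<m. \<exists>z<m. Suc x \<notin> p (Suc i) \<and> Suc y \<in> p (Suc i) \<and> Suc z \<in> p (Suc i)
        \<and> Suc y \<noteq> Suc z \<and> (Suc y, Suc x) \<notin> R (Suc i) \<and> (Suc z, Suc x) \<notin> R (Suc i))"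
    unfolding swap_test_def eval_SumLt_nonzero eval_Conj eval_Neg eval_Neq
    by (simp add: owns_iff[OF rep] prefers_iff[OF rep] cong: conj_cong del: neq0_conv)
  also have "\<dots> \<longleftrightarrow> (\<exists>i\<in>{1..n}. \<exists>x\<in>{1..m}. \<exists>y\<in>{1..m}. \<exists>z\<in>{1..m}. x \<notin> p i \<and> y \<in> p i \<and> z \<in> p i
        \<and> y \<noteq> z \<and> (y, x) \<notin> R i \<and> (z, x) \<notin> R i)"
    unfolding ex_agent ex_object ..
  also have "\<dots> \<longleftrightarrow> has_one_for_two_swap {1..n} {1..m} R p"
    unfolding has_one_for_two_swap_def using p_subset by blast
  finally have swap: "eval n m \<mu> swap_test \<sigma> \<noteq> 0 \<longleftrightarrow> has_one_for_two_swap {1..n} {1..m} R p" .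
  have "necessarily_pareto_optimal {1..n} {1..m} R p \<longleftrightarrow> \<not> eval n m \<mu> (Disj cycle_test swap_test) \<sigma>
      \<noteq> 0"
    unfolding eval_Disj cycle swap
    using necessarily_pareto_optimal_iff[OF _ _ profile assignment] by simp
  then show ?thesis
    unfolding answer_def eval_Neg by simp
qed

end

section \<open>The complete program and its running time\<close>

text \<open>
  Without objects the input consists of the binary number \<open>n\<close> only, so loops over all agents would
  take exponential time; hence the initial test of \<open>m\<close>.
\<close>

definition program :: com where
  "program = Seq (Load 1 0) (Seq (Const 2 1) (Seq (Load 2 2)
    (com.If 2
      (Seq (compile_stmt compute_reach (\<lambda>_. 0) 3) (Seq (compile_expr answer (\<lambda>_. 0) 3)
        (Seq (Const 0 0) (Add 0 0 3))))
      (Const 0 1))))"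

text \<open>Loading \<open>n\<close> and \<open>m\<close>, the test and the return of the answer
  take 7 steps, and so does the whole run for \<open>m = 0\<close>; 10 leaves room.\<close>

definition program_cost :: "nat poly" where
  "program_cost = stmt_cost compute_reach + expr_cost answer + [:10:]"

text \<open>All bundles are empty and have utility 0, so nobody can gain strictly. This justifies
  the constant answer 1 for \<open>m = 0\<close>.\<close>

lemma necessarily_pareto_optimal_empty:
  assumes "is_assignment N {} p"
  shows "necessarily_pareto_optimal N {} R p"
  using assms
  by (auto simp: necessarily_pareto_optimal_def pareto_optimal_def pareto_dominates_def
      is_assignment_def bundle_utility_def)

text \<open>The bound on \<open>n\<close> is demanded only for \<open>m \<noteq> 0\<close>: without
  objects \<open>n\<close> may be exponential in the input size, but then no loop is
  entered.\<close>

lemma runs_program: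
  assumes "(n, m, R, p) \<in> instances" "m \<noteq> 0 \<Longrightarrow> n \<le> K \<and> m \<le> K"
  shows "\<exists>\<rho> \<mu>. runs program (init_state (encode (n, m, R, p))) (poly program_cost K) (\<rho>, \<mu>)
    \<and> \<rho> 0 = of_bool (necessarily_pareto_optimal {1..n} {1..m} R p)"
proof -
  interpret decision_instance n m R p
    using assms(1) by unfold_locales
  define \<mu>0 where "\<mu>0 = snd (init_state (encode (n, m, R, p)))"
  have init: "init_state (encode (n, m, R, p)) = ((\<lambda>_. 0), \<mu>0)"
    by (simp add: \<mu>0_def init_state_def)
  have \<mu>0: "\<mu>0 0 = n" "\<mu>0 1 = m"
    by (simp_all add: \<mu>0_def init_state_def)
  define \<rho>1 :: "nat \<Rightarrow> nat" where "\<rho>1 = (\<lambda>_. 0)(1 := n)"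
  define \<rho>2 where "\<rho>2 = \<rho>1(2 := 1)"
  define \<rho>3 where "\<rho>3 = \<rho>2(2 := m)"
  have prefix: "runs program (init_state (encode (n, m, R, p))) (1 + (2 + (1 + Suc k))) s"
    if "runs (if m = 0 then Const 0 1 else
        Seq (compile_stmt compute_reach (\<lambda>_. 0) 3) (Seq (compile_expr answer (\<lambda>_. 0) 3)
          (Seq (Const 0 0) (Add 0 0 3)))) (\<rho>3, \<mu>0) k s" for k s
  proof -
    have "runs (Load 1 0) ((\<lambda>_. 0), \<mu>0) 1 (\<rho>1, \<mu>0)"
      using runs_Load[of 1 0 "\<lambda>_. 0" \<mu>0] by (simp only: \<mu>0 \<rho>1_def)
    moreover have "runs (Const 2 1) (\<rho>1, \<mu>0) 2 (\<rho>2, \<mu>0)"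
      using runs_Const[of 2 1 \<rho>1 \<mu>0] by (simp only: \<rho>2_def Suc_1)
    moreover have "runs (Load 2 2) (\<rho>2, \<mu>0) 1 (\<rho>3, \<mu>0)"
      using runs_Load[of 2 2 \<rho>2 \<mu>0] \<mu>0(2) by (simp add: \<rho>3_def \<rho>2_def)
    moreover have "runs (com.If 2
        (Seq (compile_stmt compute_reach (\<lambda>_. 0) 3) (Seq (compile_expr answer (\<lambda>_. 0) 3)
          (Seq (Const 0 0) (Add 0 0 3))))
        (Const 0 1)) (\<rho>3, \<mu>0) (Suc k) s"
      using that by (cases "m = 0") (auto intro: runs_IfZero runs_IfNonzero simp: \<rho>3_def)
    ultimately show ?thesis
      unfolding program_def init by (intro runs_Seq)
  qed
  show ?thesis
  proof (cases "m = 0")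
    case True
    have "necessarily_pareto_optimal {1..n} {1..m} R p"
      using necessarily_pareto_optimal_empty[of "{1..n}" p R] assignment True by simp
    moreover have "runs program (init_state (encode (n, m, R, p))) (1 + (2 + (1 + Suc (Suc 1))))
        (\<rho>3(0 := 1), \<mu>0)"
      by (rule prefix) (simp add: True runs_Const[of 0 1 \<rho>3 \<mu>0, simplified])
    then have "runs program (init_state (encode (n, m, R, p))) (poly program_cost K) (\<rho>3(0 := 1),
        \<mu>0)"
      by (rule runs_mono) (simp add: program_cost_def)
    ultimately show ?thesis
      by (intro exI[of _ "\<rho>3(0 := 1)"] exI[of _ \<mu>0]) simp
  next
    case False
    then have nm: "n \<le> K" "m \<le> K"
      using assms(2) by auto
    \<comment> \<open>All variables of the program are bound by a loop or a sum before they are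
      read, so each may start out in register 0.\<close>
    define \<eta> :: "nat \<Rightarrow> nat" where "\<eta> = (\<lambda>_. 0)"
    have \<eta>: "\<eta> x < 3" for x
      by (simp add: \<eta>_def)
    have \<rho>3: "\<rho>3 1 = n" "\<rho>3 2 = m"
      by (simp_all add: \<rho>1_def \<rho>2_def \<rho>3_def)
    define \<mu>1 where "\<mu>1 = run n m compute_reach (\<rho>3 \<circ> \<eta>) \<mu>0"
    obtain \<rho>4 where 4: "runs (compile_stmt compute_reach \<eta> 3) (\<rho>3, \<mu>0) (poly (stmt_cost
        compute_reach) K) (\<rho>4, \<mu>1)"
        "\<forall>r<3. \<rho>4 r = \<rho>3 r"
      using runs_compile_stmt[of \<eta> 3 \<rho>3 n m K compute_reach \<mu>0] \<eta> \<rho>3 nm unfolding \<mu>1_def by auto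
    have \<rho>4: "\<rho>4 1 = n" "\<rho>4 2 = m"
      using 4(2) \<rho>3 by simp_all
    obtain \<rho>5 where 5: "runs (compile_expr answer \<eta> 3) (\<rho>4, \<mu>1) (poly (expr_cost answer) K) (\<rho>5,
        \<mu>1)"
        "\<rho>5 3 = eval n m \<mu>1 answer (\<rho>4 \<circ> \<eta>)"
      using runs_compile_expr[of \<eta> 3 \<rho>4 n m K answer \<mu>1] \<eta> \<rho>4 nm by blast
    define \<rho>6 where "\<rho>6 = \<rho>5(0 := 0)"
    have "runs program (init_state (encode (n, m, R, p)))
       (1 + (2 + (1 + Suc (poly (stmt_cost compute_reach) K + (poly (expr_cost answer) K + (Suc 0
           + 1))))))
       (\<rho>6(0 := \<rho>6 0 + \<rho>6 3), \<mu>1)"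
      using False runs_Seq[OF 4(1) runs_Seq[OF 5(1)
            runs_Seq[OF runs_Const[of 0 0 \<rho>5 \<mu>1, folded \<rho>6_def] runs_Add[of 0 0 3 \<rho>6 \<mu>1]]]]
      by (intro prefix) (simp add: \<eta>_def del: One_nat_def)
    then have "runs program (init_state (encode (n, m, R, p))) (poly program_cost K) (\<rho>6(0 := \<rho>6 0
        + \<rho>6 3), \<mu>1)"
      by (rule runs_mono) (simp add: program_cost_def)
    moreover have "represents (n, m, R, p) \<mu>0"
      unfolding \<mu>0_def by (rule represents_encode)
    \<comment> \<open>The table begins right behind the input, where memory is initially 0.\<close>
    moreover have "reach n m \<mu>0 = {}"
      unfolding reach_def \<mu>0_def init_state_def length_encode by auto
    ultimately show ?thesis
      using eval_answer[OF run_compute_reach[of \<mu>0 "\<rho>3 \<circ> \<eta>", folded \<mu>1_def]] 5(2)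
      by (intro exI[of _ "\<rho>6(0 := \<rho>6 0 + \<rho>6 3)"] exI[of _ \<mu>1]) (simp add: \<rho>6_def)
  qed
qed

lemma length_le_input_size: "length ws \<le> input_size ws"
  unfolding input_size_def by (induction ws) (auto simp: lcost_def)

text \<open>The cost of a word exceeds its length, and the input size adds up these costs; so the
  input size itself can serve as initial bit bound.\<close>

lemma bits_le_init_state: "bits_le (init_state ws) (input_size ws)"
proof -
  have "w < 2 ^ input_size ws" if "w \<in> set ws" for w
  proof -
    have "lcost w \<le> input_size ws"
      unfolding input_size_def using that by (intro member_le_sum_list) auto
    then show ?thesis
      by (intro floorlog_leD) (auto simp: lcost_def)
  qed
  then show ?thesis
    by (auto simp: bits_le_def init_state_def)
qed

theorem mainTheorem11:
  shows "polynomial_time_decidable instances encode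
           (\<lambda>(n, m, R, p). necessarily_pareto_optimal {1..n} {1..m} R p)"
  unfolding polynomial_time_decidable_def
\<comment> \<open>With \<open>k\<close> unit steps on numbers of \<open>B\<close> bits the time is
  at most \<open>k * (2 * (B + k) + 2)\<close>. Here \<open>B\<close> is the input size, represented
  by \<open>[:0, 1:]\<close>, and \<open>k\<close> is given by \<open>program_cost\<close>.\<close>
proof (rule exI[of _ program], rule exI[of _ "program_cost * ([:2:] * ([:0, 1:] + program_cost) +
    [:2:])"], rule ballI)
  fix x
  assume x: "x \<in> instances"
  obtain n m R p where x_eq: "x = (n, m, R, p)"
    by (cases x) auto
  define K where "K = input_size (encode x)"
  have "n \<le> K \<and> m \<le> K" if "m \<noteq> 0"
  proof -
    have "n \<noteq> 0"
    proof
      assume "n = 0"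
      then have "{1..m} = {}"
        using x by (simp add: x_eq instances_def is_assignment_def)
      then show False
        using that by simp
    qed
    \<comment> \<open>The characteristic vectors alone fill \<open>n * m\<close> cells, so with both
      factors nonzero each of them is at most the input length.\<close>
    have "n * 1 \<le> n * m" "1 * m \<le> n * m"
      using that \<open>n \<noteq> 0\<close> by (intro mult_le_mono; simp)+
    moreover have "n * m \<le> K"
      using length_le_input_size[of "encode x"] unfolding K_def x_eq length_encode by linarith
    ultimately show ?thesis
      by linarith
  qed
  then obtain \<rho> \<mu> where run: "runs program (init_state (encode x)) (poly program_cost K) (\<rho>, \<mu>)"
      and \<rho>: "\<rho> 0 = of_bool (necessarily_pareto_optimal {1..n} {1..m} R p)"
    using runs_program[of n m R p K] x unfolding x_eq by blast
  obtain t where "exec program (init_state (encode x)) t (\<rho>, \<mu>)"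
      "t \<le> poly program_cost K * (2 * (K + poly program_cost K) + 2)"
    using run bits_le_init_state[of "encode x"] unfolding runs_def K_def by blast
  moreover have "poly (program_cost * ([:2:] * ([:0, 1:] + program_cost) + [:2:])) K
      = poly program_cost K * (2 * (K + poly program_cost K) + 2)"
    by simp
  ultimately show "\<exists>t \<rho> \<mu>. exec program (init_state (encode x)) t (\<rho>, \<mu>) \<and>
      t \<le> poly (program_cost * ([:2:] * ([:0, 1:] + program_cost) + [:2:])) (input_size (encode
          x)) \<and>
      \<rho> 0 = (if (case x of (n, m, R, p) \<Rightarrow> necessarily_pareto_optimal {1..n} {1..m} R p) then 1
          else 0)"
    using \<rho> unfolding K_def x_eq by (intro exI[of _ t] exI[of _ \<rho>] exI[of _ \<mu>]) (simp del:
        encode.simps)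
qed

end
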